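(* Let $f:\mathbb{N}\to\mathbb{N}$ be a non-decreasing function that tends to infinity. There exists an infinite, finitely generated profinite group $G$ such that $R_n(G)<f(n)$ for infinitely many $n$. In other words, there is no non-decreasing function $f:\mathbb{N}\to\mathbb{N}$ tending to infinity such that, for every infinite, finitely generated profinite group $G$, $f(n)<R_n(G)$ for all sufficiently large $n$.
   Context: For a finitely generated, residually finite (in particular, profinite) group $G$, $r_n(G)$ (possibly $\infty$) denotes the number of inequivalent complex irreducible representations of $G$ of dimension $n$ whose kernels have finite index in $G$, and $R_n(G)=\sum_{i=1}^n r_i(G)$. *)

theory Defs
  imports
    "HOL-Analysis.Analysis"
    "HOL-Algebra.Algebra"
    "HOL-Library.Extended_Nat"
    "Jordan_Normal_Form.VS_Connect"
begin

definition topological_group :: "('a, 'b) monoid_scheme \<Rightarrow> 'a topology \<Rightarrow> bool" where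
  "topological_group G T \<longleftrightarrow>
     group G \<and> topspace T = carrier G \<and>
     continuous_map (prod_topology T T) T (\<lambda>(x, y). x \<otimes>\<^bsub>G\<^esub> y) \<and>
     continuous_map T T (\<lambda>x. inv\<^bsub>G\<^esub> x)"

definition totally_disconnected :: "'a topology \<Rightarrow> bool" where
  "totally_disconnected T \<longleftrightarrow> (\<forall>S. connectedin T S \<longrightarrow> (\<exists>x. S \<subseteq> {x}))"

definition profinite_group :: "('a, 'b) monoid_scheme \<Rightarrow> 'a topology \<Rightarrow> bool" where
  "profinite_group G T \<longleftrightarrow>
     topological_group G T \<and> compact_space T \<and> Hausdorff_space T \<and> totally_disconnected T"

text \<open>For profinite groups, finite generation is understood topologically: some finite subset
  generates a dense subgroup.\<close>

definition topologically_finitely_generated ::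
    "('a, 'b) monoid_scheme \<Rightarrow> 'a topology \<Rightarrow> bool" where
  "topologically_finitely_generated G T \<longleftrightarrow>
     (\<exists>S. finite S \<and> S \<subseteq> carrier G \<and> T closure_of (generate G S) = topspace T)"

definition GL :: "nat \<Rightarrow> complex mat monoid" where
  "GL n = units_of (ring_mat TYPE(complex) n ())"

definition invariant_subspace ::
    "('a, 'b) monoid_scheme \<Rightarrow> nat \<Rightarrow> ('a \<Rightarrow> complex mat) \<Rightarrow> complex vec set \<Rightarrow> bool" where
  "invariant_subspace G n \<rho> W \<longleftrightarrow>
     VectorSpace.subspace class_ring W (module_vec TYPE(complex) n) \<and>
     (\<forall>g \<in> carrier G. \<forall>w \<in> W. \<rho> g *\<^sub>v w \<in> W)"

definition irreducible_rep ::
    "('a, 'b) monoid_scheme \<Rightarrow> nat \<Rightarrow> ('a \<Rightarrow> complex mat) \<Rightarrow> bool" where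
  "irreducible_rep G n \<rho> \<longleftrightarrow>
     \<rho> \<in> hom G (GL n) \<and> n > 0 \<and>
     (\<forall>W. invariant_subspace G n \<rho> W \<longrightarrow> W = {0\<^sub>v n} \<or> W = carrier_vec n)"

definition equivalent_reps ::
    "('a, 'b) monoid_scheme \<Rightarrow> nat \<Rightarrow> ('a \<Rightarrow> complex mat) \<Rightarrow> ('a \<Rightarrow> complex mat) \<Rightarrow> bool" where
  "equivalent_reps G n \<rho> \<sigma> \<longleftrightarrow>
     (\<exists>P \<in> carrier (GL n). \<forall>g \<in> carrier G. P * \<rho> g = \<sigma> g * P)"

text \<open>Finite index of the kernel is taken in the underlying abstract group; no continuity is
  imposed on the representations.\<close>

definition finite_index_irreps ::
    "('a, 'b) monoid_scheme \<Rightarrow> nat \<Rightarrow> ('a \<Rightarrow> complex mat) set" where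
  "finite_index_irreps G n =
     {\<rho>. irreducible_rep G n \<rho> \<and> finite (rcosets\<^bsub>G\<^esub> (kernel G (GL n) \<rho>))}"

definition irrep_classes ::
    "('a, 'b) monoid_scheme \<Rightarrow> nat \<Rightarrow> ('a \<Rightarrow> complex mat) set set" where
  "irrep_classes G n =
     finite_index_irreps G n //
       {(\<rho>, \<sigma>) \<in> finite_index_irreps G n \<times> finite_index_irreps G n. equivalent_reps G n \<rho> \<sigma>}"

definition r_irr :: "('a, 'b) monoid_scheme \<Rightarrow> nat \<Rightarrow> enat" where
  "r_irr G n = (if finite (irrep_classes G n) then enat (card (irrep_classes G n)) else \<infinity>)"

definition R_irr :: "('a, 'b) monoid_scheme \<Rightarrow> nat \<Rightarrow> enat" where
  "R_irr G n = (\<Sum>i = 1..n. r_irr G i)"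

text \<open>Every topologically finitely generated profinite group is topologically isomorphic to a
  closed subgroup of a countable product of finite groups with elements in the natural numbers.
  Hence quantifying over groups with elements of type \<^typ>\<open>nat \<Rightarrow> nat\<close> covers all of them up to
  isomorphism.\<close>

end

theory Submission
  imports Defs "Jordan_Normal_Form.Spectral_Radius" "HOL-Number_Theory.Cong"
begin

hide_const (open) Divisibility.prime

text \<open>
  The group is \<open>G = \<Prod>\<^sub>j SL\<^sub>2(\<int>/p\<^sub>j)\<close> for primes \<open>p\<^sub>0 < p\<^sub>1 < \<dots>\<close> that grow fast enough. Every factor
  is \<open>U L U L\<close>, where \<open>U\<close> and \<open>L\<close> are the cyclic groups of upper and lower unipotent matrices, so by the
  Chinese remainder theorem the two sequences of elementary matrices generate a dense subgroup.

  A unipotent element \<open>z\<close> of \<open>G\<close> is conjugate to \<open>z\<^sup>4\<close>, by a diagonal matrix. Hence for a representation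
  \<open>\<rho>\<close> of dimension at most \<open>n\<close> the eigenvalues of \<open>\<rho> z\<close> are closed under \<open>\<lambda> \<mapsto> \<lambda>\<^sup>4\<close>; by pigeonhole they are
  roots of unity of order dividing \<open>D = (4\<^sup>n)!\<close>. If \<open>\<rho>\<close> has finite image this gives \<open>\<rho> z\<^sup>D = 1\<close>. When \<open>z\<close> lives
  on the factors with \<open>p\<^sub>j > 4\<^sup>n\<close>, it is itself a \<open>D\<close>-th power of such an element, so \<open>\<rho>\<close> is trivial on
  these factors. No appeal to the theorem of Nikolov and Segal is needed, although \<open>\<rho>\<close> need not be continuous.

  So all representations of dimension at most \<open>n\<close> factor through a finite product \<open>H\<close> of the first
  factors, and by Schur's lemma there are at most \<open>|H|\<close> of them. Since \<open>H\<close> depends on the first primes only,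
  one can choose \<open>n\<close> with \<open>|H| < f n\<close> and then the next prime larger than \<open>4\<^sup>n\<close>.
\<close>

section \<open>Eigenvalues of matrices conjugate to a power\<close>

text \<open>An eigenvector \<open>v\<close> of \<open>Y\<close> with eigenvalue \<open>m\<close>
  yields the eigenvector \<open>P *\<^sub>v v\<close> with eigenvalue \<open>m ^ q\<close>, because
  \<open>Y * P = P * Y ^\<^sub>m q\<close> and \<open>P\<close> is injective. So all
  \<open>l ^ (q ^ k)\<close> are eigenvalues; as there are at most \<open>n\<close> of these, two
  with \<open>k\<close> up to \<open>n\<close> coincide. The factorial serves as an exponent that
  depends on \<open>q\<close> and \<open>n\<close> alone.\<close>

lemma eigenvalues_roots_of_unity:
  fixes Y P :: "complex mat"
  assumes Y: "Y \<in> carrier_mat i i" and P: "P \<in> carrier_mat i i" and Q: "Q \<in> carrier_mat i i"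
    and inv: "Q * P = 1\<^sub>m i"
    and rel: "P * Y ^\<^sub>m q = Y * P"
    and q: "q > 1" and "i \<le> n" and ev: "eigenvalue Y l" and l0: "l \<noteq> 0"
  shows "l ^ fact (q ^ n) = 1"
proof -
  have step: "eigenvalue Y (m ^ q)" if ev: "eigenvalue Y m" for m
  proof -
    obtain v where v: "v \<in> carrier_vec i" "v \<noteq> 0\<^sub>v i" "Y *\<^sub>v v = m \<cdot>\<^sub>v v"
      using ev Y unfolding eigenvalue_def eigenvector_def by auto
    have pw: "Y ^\<^sub>m q *\<^sub>v v = m ^ q \<cdot>\<^sub>v v"
      using eigenvector_pow[OF Y, of v m q] v Y unfolding eigenvector_def by auto
    have Yq: "Y ^\<^sub>m q \<in> carrier_mat i i" using Y by simp
    have "Y *\<^sub>v (P *\<^sub>v v) = (P * Y ^\<^sub>m q) *\<^sub>v v"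
      using Y P v by (simp add: rel)
    also have "\<dots> = P *\<^sub>v (m ^ q \<cdot>\<^sub>v v)"
      using assoc_mult_mat_vec[OF P Yq v(1)] pw by simp
    also have "\<dots> = m ^ q \<cdot>\<^sub>v (P *\<^sub>v v)"
      using mult_mat_vec[OF P v(1)] by simp
    finally have 1: "Y *\<^sub>v (P *\<^sub>v v) = m ^ q \<cdot>\<^sub>v (P *\<^sub>v v)" .
    have "P *\<^sub>v v \<noteq> 0\<^sub>v i"
    proof
      assume "P *\<^sub>v v = 0\<^sub>v i"
      hence "Q *\<^sub>v (P *\<^sub>v v) = 0\<^sub>v i" using Q by (simp add: mult_mat_vec_def) (auto intro!: eq_vecI)
      moreover have "Q *\<^sub>v (P *\<^sub>v v) = v"
        using assoc_mult_mat_vec[OF Q P v(1)] inv v by simp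
      ultimately show False using v by simp
    qed
    thus ?thesis using 1 Y P v unfolding eigenvalue_def eigenvector_def
      by (intro exI[of _ "P *\<^sub>v v"]) auto
  qed
  have ev': "eigenvalue Y (l ^ (q ^ k))" for k
  proof (induction k)
    case (Suc k)
    from step[OF this] show ?case by (simp add: power_mult[symmetric] mult.commute)
  qed (simp add: ev)
  have "card ((\<lambda>k. l ^ (q ^ k)) ` {..n}) \<le> card (spectrum Y)"
    using card_finite_spectrum(1)[OF Y] ev' by (intro card_mono) (auto simp: spectrum_def)
  also have "\<dots> < card {..n}" using card_finite_spectrum(2)[OF Y] \<open>i \<le> n\<close> by simp
  finally have "\<not> inj_on (\<lambda>k. l ^ (q ^ k)) {..n}" using pigeonhole by blast
  then obtain a b where ab: "a < b" "b \<le> n" "l ^ (q ^ a) = l ^ (q ^ b)"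
    unfolding inj_on_def by (metis atMost_iff linorder_neqE_nat)
  have lt: "q ^ a < q ^ b" using ab q by simp
  have "l ^ (q ^ a) * l ^ (q ^ b - q ^ a) = l ^ (q ^ a)"
    using ab(3) lt by (metis le_add_diff_inverse less_imp_le power_add)
  hence 1: "l ^ (q ^ b - q ^ a) = 1" using l0 by simp
  have "q ^ b \<le> q ^ n" using ab q by (simp add: power_increasing)
  hence "q ^ b - q ^ a dvd fact (q ^ n)"
    using lt by (intro dvd_fact) auto
  thus ?thesis using 1 by (metis dvd_def power_mult power_one)
qed

lemma pow_mat_commute:
  assumes "Y \<in> carrier_mat i i"
  shows "Y ^\<^sub>m k * Y = Y * Y ^\<^sub>m k"
proof (induction k)
  case (Suc k)
  thus ?case using assoc_mult_mat[OF assms pow_carrier_mat[OF assms, of k] assms] by simp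
qed (use assms in auto)

text \<open>A matrix of finite order is diagonalisable, so its eigenvalues determine when its
  \<open>D\<close>-th power is trivial. Diagonalisation is replaced by a discrete Fourier transform
  of length \<open>N\<close>: every basis vector is an average of vectors that are eigenvectors or
  zero, and \<open>Y ^\<^sub>m D\<close> fixes each of them.\<close>

lemma pow_mat_fourier:
  fixes Y :: "complex mat"
  assumes Y: "Y \<in> carrier_mat i i" and N: "N > 0" "Y ^\<^sub>m N = 1\<^sub>m i"
    and ev: "\<And>l. eigenvalue Y l \<Longrightarrow> l ^ D = 1"
  shows "Y ^\<^sub>m D = 1\<^sub>m i"
proof -
  \<comment> \<open>A primitive \<open>N\<close>-th root of unity.\<close>
  define z where "z = exp (2 * of_real pi * \<i> * of_nat 1 / of_nat N)"
  have zk: "z ^ k = exp (2 * of_real pi * \<i> * of_nat k / of_nat N)" for k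
    unfolding z_def by (simp flip: exp_of_nat_mult add: mult_ac)
  have zN: "z ^ N = 1" using complex_root_unity[of N 1] N unfolding z_def by simp
  have z0: "z \<noteq> 0" unfolding z_def by simp
  have zk1: "z ^ k \<noteq> 1" if "0 < k" "k < N" for k
    using complex_root_unity_eq_1[of N k] that unfolding zk by (auto dest: dvd_imp_le)
  show ?thesis
  proof (rule eq_matI)
    fix a b assume "a < dim_row (1\<^sub>m i :: complex mat)" "b < dim_col (1\<^sub>m i :: complex mat)"
    hence a: "a < i" and b: "b < i" by auto
    define v :: "complex vec" where "v = unit_vec i b"
    have v: "v \<in> carrier_vec i" unfolding v_def by simp
    have pv: "Y ^\<^sub>m k *\<^sub>v v \<in> carrier_vec i" for k
      by (rule mult_mat_vec_carrier[OF pow_carrier_mat[OF Y] v])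
    \<comment> \<open>the projection of \<open>v\<close> to the eigenspace of \<open>z ^ j\<close>, up to the factor \<open>N\<close>\<close>
    define w where "w j = vec i (\<lambda>a. \<Sum>k<N. inverse z ^ (j * k) * (Y ^\<^sub>m k *\<^sub>v v) $ a)" for j
    have w: "w j \<in> carrier_vec i" for j unfolding w_def by simp
    have Yw: "Y *\<^sub>v w j = z ^ j \<cdot>\<^sub>v w j" for j
    proof (rule eq_vecI)
      fix c assume "c < dim_vec (z ^ j \<cdot>\<^sub>v w j)"
      hence c: "c < i" by (simp add: w_def)
      define f where "f k = inverse z ^ (j * k) * (Y ^\<^sub>m k *\<^sub>v v) $ c" for k
      have Yk: "(\<Sum>d<i. Y $$ (c, d) * (Y ^\<^sub>m k *\<^sub>v v) $ d) = (Y ^\<^sub>m Suc k *\<^sub>v v) $ c" for k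
      proof -
        have "Y ^\<^sub>m Suc k *\<^sub>v v = Y *\<^sub>v (Y ^\<^sub>m k *\<^sub>v v)"
          using assoc_mult_mat_vec[OF Y pow_carrier_mat[OF Y] v, of k]
          by (simp add: pow_mat_commute[OF Y])
        thus ?thesis using c Y pv[of k] by (simp add: scalar_prod_def lessThan_atLeast0)
      qed
      have "(Y *\<^sub>v w j) $ c = (\<Sum>d<i. Y $$ (c, d) * (\<Sum>k<N. inverse z ^ (j * k) * (Y ^\<^sub>m k *\<^sub>v v) $ d))"
        using c Y by (simp add: w_def scalar_prod_def lessThan_atLeast0)
      also have "\<dots> = (\<Sum>k<N. inverse z ^ (j * k) * (\<Sum>d<i. Y $$ (c, d) * (Y ^\<^sub>m k *\<^sub>v v) $ d))"
        unfolding sum_distrib_left by (subst sum.swap) (simp add: mult_ac)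
      also have "\<dots> = (\<Sum>k<N. z ^ j * f (Suc k))"
        unfolding Yk f_def using z0 by (intro sum.cong) (auto simp: power_add field_simps)
      also have "\<dots> = z ^ j * (\<Sum>k<N. f (Suc k))" by (simp add: sum_distrib_left)
      \<comment> \<open>The shift trades the term at 0 for the term at \<open>N\<close>; they agree
        since \<open>z ^ N\<close> and \<open>Y ^\<^sub>m N\<close> are both trivial.\<close>
      also have "(\<Sum>k<N. f (Suc k)) = (\<Sum>k<N. f k) - f 0 + f N"
        using sum.lessThan_Suc_shift[of f N] by (simp add: algebra_simps)
      also have "f N = f 0"
      proof -
        have "inverse z ^ (j * N) = 1"
          using zN by (simp add: mult.commute[of j] power_mult power_inverse)
        thus ?thesis using N Y unfolding f_def by simp
      qed
      finally show "(Y *\<^sub>v w j) $ c = (z ^ j \<cdot>\<^sub>v w j) $ c" using c by (simp add: w_def f_def)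
    qed (use Y w in \<open>auto simp: w_def\<close>)
    have YDw: "Y ^\<^sub>m D *\<^sub>v w j = w j" for j
    proof (cases "w j = 0\<^sub>v i")
      case True
      thus ?thesis using Y by (auto intro!: eq_vecI)
    next
      case False
      hence e: "eigenvector Y (w j) (z ^ j)" using Yw w Y unfolding eigenvector_def by auto
      hence "(z ^ j) ^ D = 1" using ev unfolding eigenvalue_def by blast
      thus ?thesis using eigenvector_pow[OF Y e, of D] by simp
    qed
    \<comment> \<open>Fourier inversion: the sum over \<open>j\<close> is geometric and vanishes
      unless \<open>k = 0\<close>.\<close>
    have sumw: "(\<Sum>j<N. w j $ c) = of_nat N * v $ c" if c: "c < i" for c
    proof -
      have "(\<Sum>j<N. w j $ c) = (\<Sum>k<N. (\<Sum>j<N. inverse z ^ (j * k)) * (Y ^\<^sub>m k *\<^sub>v v) $ c)"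
        using c unfolding w_def sum_distrib_right by (simp, subst sum.swap, simp)
      also have "\<dots> = (\<Sum>k<N. if k = 0 then of_nat N * v $ c else 0)"
      proof (intro sum.cong refl)
        fix k assume k: "k \<in> {..<N}"
        show "(\<Sum>j<N. inverse z ^ (j * k)) * (Y ^\<^sub>m k *\<^sub>v v) $ c = (if k = 0 then of_nat N * v $ c else 0)"
        proof (cases "k = 0")
          case True thus ?thesis using Y v by simp
        next
          case False
          have ne: "inverse z ^ k \<noteq> 1" using zk1[of k] k False
            by (simp add: power_inverse inverse_eq_1_iff)
          have "(\<Sum>j<N. (inverse z ^ k) ^ j) = (((inverse z ^ k) ^ N) - 1) / (inverse z ^ k - 1)"
            by (rule geometric_sum[OF ne])
          also have "(inverse z ^ k) ^ N = 1"
            using zN by (metis power_mult mult.commute power_inverse inverse_1 power_one)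
          finally have "(\<Sum>j<N. inverse z ^ (j * k)) = 0"
            by (simp add: power_mult[symmetric] mult.commute)
          thus ?thesis using False by simp
        qed
      qed
      also have "\<dots> = of_nat N * v $ c" using N by (simp add: sum.delta)
      finally show ?thesis .
    qed
    have YD: "Y ^\<^sub>m D \<in> carrier_mat i i" using Y by simp
    \<comment> \<open>\<open>Y ^\<^sub>m D\<close> is applied to \<open>N\<close> times
      \<open>v\<close>, written as the sum of the vectors \<open>w j\<close>, each of which it
      fixes.\<close>
    have "of_nat N * (Y ^\<^sub>m D *\<^sub>v v) $ a = (\<Sum>d<i. (Y ^\<^sub>m D) $$ (a, d) * (of_nat N * v $ d))"
    proof -
      have "(Y ^\<^sub>m D *\<^sub>v v) $ a = (\<Sum>d<i. (Y ^\<^sub>m D) $$ (a, d) * v $ d)"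
        using carrier_matD[OF YD] carrier_vecD[OF v] a
        by (simp add: scalar_prod_def lessThan_atLeast0)
      thus ?thesis by (simp add: sum_distrib_left mult_ac)
    qed
    also have "\<dots> = (\<Sum>d<i. (Y ^\<^sub>m D) $$ (a, d) * (\<Sum>j<N. w j $ d))"
      by (intro sum.cong) (auto simp: sumw)
    also have "\<dots> = (\<Sum>j<N. \<Sum>d<i. (Y ^\<^sub>m D) $$ (a, d) * w j $ d)"
      unfolding sum_distrib_left by (rule sum.swap)
    also have "\<dots> = (\<Sum>j<N. (Y ^\<^sub>m D *\<^sub>v w j) $ a)"
      using carrier_matD[OF YD] a by (simp add: scalar_prod_def lessThan_atLeast0 w_def)
    also have "\<dots> = of_nat N * v $ a" unfolding YDw by (rule sumw[OF a])
    finally have "(Y ^\<^sub>m D *\<^sub>v v) $ a = v $ a" using N by simp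
    thus "(Y ^\<^sub>m D) $$ (a, b) = 1\<^sub>m i $$ (a, b)"
      using carrier_matD[OF YD] a b unfolding v_def by simp
  qed (use Y in auto)
qed

section \<open>Counting irreducible representations\<close>

lemma GL_carrier_iff:
  "A \<in> carrier (GL n) \<longleftrightarrow>
     A \<in> carrier_mat n n \<and> (\<exists>B \<in> carrier_mat n n. A * B = 1\<^sub>m n \<and> B * A = 1\<^sub>m n)"
  unfolding GL_def units_of_def Units_def by (auto simp: ring_mat_simps)

lemma GL_mult [simp]: "x \<otimes>\<^bsub>GL n\<^esub> y = x * y"
  and GL_one [simp]: "\<one>\<^bsub>GL n\<^esub> = 1\<^sub>m n"
  by (simp_all add: GL_def units_of_def ring_mat_simps)

lemma group_GL: "group (GL n)"
  unfolding GL_def using ring.ring_simprules ring_mat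
  by (metis monoid.units_group ring.is_monoid)

lemma rep_carrier: "\<rho> \<in> hom G (GL n) \<Longrightarrow> g \<in> carrier G \<Longrightarrow> \<rho> g \<in> carrier_mat n n"
  using GL_carrier_iff unfolding hom_def by (metis (no_types, lifting) PiE mem_Collect_eq)

lemma rep_mult:
  "\<rho> \<in> hom G (GL n) \<Longrightarrow> g \<in> carrier G \<Longrightarrow> h \<in> carrier G \<Longrightarrow> \<rho> (g \<otimes>\<^bsub>G\<^esub> h) = \<rho> g * \<rho> h"
  unfolding hom_def by simp

lemma rep_one: "group G \<Longrightarrow> \<rho> \<in> hom G (GL n) \<Longrightarrow> \<rho> \<one>\<^bsub>G\<^esub> = 1\<^sub>m n"
  using hom_one[OF _ _ group_GL] by fastforce

lemma vec_subspaceI: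
  fixes W :: "complex vec set"
  assumes "W \<subseteq> carrier_vec n" "0\<^sub>v n \<in> W"
    and "\<And>v w. v \<in> W \<Longrightarrow> w \<in> W \<Longrightarrow> v + w \<in> W"
    and "\<And>c v. v \<in> W \<Longrightarrow> c \<cdot>\<^sub>v v \<in> W"
  shows "VectorSpace.subspace class_ring W (module_vec TYPE(complex) n)"
  unfolding VectorSpace.subspace_def submodule_def
  using assms vec_vs[of n] vec_module[of n] by (auto simp: module_vec_simps)

lemma mult_mat_zero_vec:
  "A \<in> carrier_mat i m \<Longrightarrow> A *\<^sub>v 0\<^sub>v m = (0\<^sub>v i :: complex vec)"
  by (intro eq_vecI) auto

text \<open>Kernel and image of the intertwiner \<open>T\<close> are invariant subspaces, so a
  nonzero \<open>T\<close> is bijective. The dimensions \<open>i\<close> and \<open>m\<close> may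
  differ at the outset, so that representations of different dimensions are separated as
  well.\<close>

lemma irreducible_schur:
  assumes G: "group G" and r: "irreducible_rep G i \<rho>" and s: "irreducible_rep G m \<sigma>"
    and T: "T \<in> carrier_mat i m" "T \<noteq> 0\<^sub>m i m"
    and tw: "\<And>g. g \<in> carrier G \<Longrightarrow> \<rho> g * T = T * \<sigma> g"
  shows "i = m \<and> equivalent_reps G i \<sigma> \<rho>"
proof -
  have rh: "\<rho> \<in> hom G (GL i)" and sh: "\<sigma> \<in> hom G (GL m)"
    using r s unfolding irreducible_rep_def by auto
  note rc = rep_carrier[OF rh] and sc = rep_carrier[OF sh]
  define K where "K = {v \<in> carrier_vec m. T *\<^sub>v v = 0\<^sub>v i}"
  define I where "I = (\<lambda>v. T *\<^sub>v v) ` carrier_vec m"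
  have Tc: "T *\<^sub>v v \<in> carrier_vec i" if "v \<in> carrier_vec m" for v
    using mult_mat_vec_carrier[OF T(1) that] .
  have T0: "T *\<^sub>v 0\<^sub>v m = 0\<^sub>v i" by (rule mult_mat_zero_vec[OF T(1)])
  have "\<exists>v\<in>carrier_vec m. T *\<^sub>v v \<noteq> 0\<^sub>v i"
  proof (rule ccontr)
    assume *: "\<not> ?thesis"
    have "T $$ (a, b) = 0" if "a < i" "b < m" for a b
    proof -
      have "(T *\<^sub>v unit_vec m b) $ a = 0" using * that by simp
      thus ?thesis using that T by simp
    qed
    hence "T = 0\<^sub>m i m" using T by (intro eq_matI) auto
    thus False using T by simp
  qed
  then obtain v0 where v0: "v0 \<in> carrier_vec m" "T *\<^sub>v v0 \<noteq> 0\<^sub>v i" by blast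
  have tv: "T *\<^sub>v (\<sigma> g *\<^sub>v v) = \<rho> g *\<^sub>v (T *\<^sub>v v)" if "g \<in> carrier G" "v \<in> carrier_vec m" for g v
    using assoc_mult_mat_vec[OF T(1) sc[OF that(1)] that(2)]
      assoc_mult_mat_vec[OF rc[OF that(1)] T(1) that(2)] tw[OF that(1)] by simp
  have "VectorSpace.subspace class_ring K (module_vec TYPE(complex) m)"
    using T T0 unfolding K_def
    by (intro vec_subspaceI) (auto simp: mult_add_distrib_mat_vec[OF T(1)] mult_mat_vec[OF T(1)])
  hence "invariant_subspace G m \<sigma> K"
    unfolding invariant_subspace_def K_def
    using tv mult_mat_vec_carrier[OF sc] mult_mat_zero_vec[OF rc] by auto
  hence "K = {0\<^sub>v m} \<or> K = carrier_vec m" using s unfolding irreducible_rep_def by blast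
  hence K: "K = {0\<^sub>v m}" using v0 unfolding K_def by auto
  have "VectorSpace.subspace class_ring I (module_vec TYPE(complex) i)"
  proof (rule vec_subspaceI)
    show "0\<^sub>v i \<in> I" unfolding I_def using T0 by (metis imageI zero_carrier_vec)
    fix v w assume "v \<in> I" "w \<in> I"
    then obtain v' w' where "v' \<in> carrier_vec m" "w' \<in> carrier_vec m" "v = T *\<^sub>v v'" "w = T *\<^sub>v w'"
      unfolding I_def by auto
    thus "v + w \<in> I" unfolding I_def
      by (intro image_eqI[of _ _ "v' + w'"]) (auto simp: mult_add_distrib_mat_vec[OF T(1)])
  next
    fix c v assume "v \<in> I"
    then obtain v' where "v' \<in> carrier_vec m" "v = T *\<^sub>v v'" unfolding I_def by auto
    thus "c \<cdot>\<^sub>v v \<in> I" unfolding I_def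
      by (intro image_eqI[of _ _ "c \<cdot>\<^sub>v v'"]) (auto simp: mult_mat_vec[OF T(1)])
  qed (auto simp: I_def Tc)
  moreover have "\<rho> g *\<^sub>v w \<in> I" if g: "g \<in> carrier G" and w: "w \<in> I" for g w
  proof -
    obtain v where v: "v \<in> carrier_vec m" "w = T *\<^sub>v v" using w unfolding I_def by auto
    have "\<rho> g *\<^sub>v w = T *\<^sub>v (\<sigma> g *\<^sub>v v)" using tv[OF g v(1)] v by simp
    thus ?thesis unfolding I_def using mult_mat_vec_carrier[OF sc[OF g] v(1)] by blast
  qed
  ultimately have "I = {0\<^sub>v i} \<or> I = carrier_vec i"
    using r unfolding irreducible_rep_def invariant_subspace_def by blast
  hence I: "I = carrier_vec i" using v0 unfolding I_def by auto
  \<comment> \<open>Preimages of the unit vectors, which exist by surjectivity, are the columns of a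
    right inverse \<open>B\<close>.\<close>
  have "\<forall>a. \<exists>v. v \<in> carrier_vec m \<and> T *\<^sub>v v = unit_vec i a"
    using I unfolding I_def by (metis (no_types, lifting) imageE unit_vec_carrier)
  then obtain w where w: "\<And>a. w a \<in> carrier_vec m" "\<And>a. T *\<^sub>v w a = unit_vec i a" by metis
  define B where "B = mat m i (\<lambda>(c, a). w a $ c)"
  have B: "B \<in> carrier_mat m i" unfolding B_def by simp
  have colB: "col B a = w a" if "a < i" for a
    using w(1)[of a] that unfolding B_def by (intro eq_vecI) auto
  have TB: "T * B = 1\<^sub>m i"
  proof (rule eq_matI)
    fix a b assume "a < dim_row (1\<^sub>m i :: complex mat)" "b < dim_col (1\<^sub>m i :: complex mat)"
    hence ab: "a < i" "b < i" by auto
    have "(T * B) $$ (a, b) = (T *\<^sub>v w b) $ a" using ab T B colB[of b] by simp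
    thus "(T * B) $$ (a, b) = 1\<^sub>m i $$ (a, b)" using w ab by simp
  qed (use T B in auto)
  have inj: "v = v'" if "v \<in> carrier_vec m" "v' \<in> carrier_vec m" "T *\<^sub>v v = T *\<^sub>v v'" for v v'
  proof -
    have "T *\<^sub>v (v - v') = 0\<^sub>v i"
      using that T by (subst mult_minus_distrib_mat_vec) auto
    hence "v - v' \<in> K" using that unfolding K_def by auto
    hence "v - v' = 0\<^sub>v m" using K by simp
    hence "(v - v') $ a = 0" if "a < m" for a using that by simp
    thus ?thesis using that by (intro eq_vecI) auto
  qed
  have BT: "B * T = 1\<^sub>m m"
  proof (rule eq_matI)
    fix a b assume "a < dim_row (1\<^sub>m m :: complex mat)" "b < dim_col (1\<^sub>m m :: complex mat)"
    hence ab: "a < m" "b < m" by auto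
    have c: "col T b = T *\<^sub>v unit_vec m b" using T ab by (intro eq_vecI) auto
    have Tb: "col T b \<in> carrier_vec i" using carrier_matD[OF T(1)] by (intro carrier_vecI) simp
    \<comment> \<open>Column \<open>b\<close> of \<open>B * T\<close> and the unit vector have the
      same image under \<open>T\<close>, so injectivity identifies them.\<close>
    have "T *\<^sub>v (B *\<^sub>v col T b) = T *\<^sub>v unit_vec m b"
      using assoc_mult_mat_vec[OF T(1) B Tb] Tb c by (simp add: TB)
    hence "B *\<^sub>v col T b = unit_vec m b"
      using inj[OF mult_mat_vec_carrier[OF B Tb], of "unit_vec m b"] by simp
    hence "(B *\<^sub>v col T b) $ a = unit_vec m b $ a" by simp
    thus "(B * T) $$ (a, b) = 1\<^sub>m m $$ (a, b)" using ab B T by simp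
  qed (use T B in auto)
  \<comment> \<open>comparing the traces of \<open>T * B\<close> and \<open>B * T\<close> gives \<open>i = m\<close>\<close>
  have "(\<Sum>a<i. (T * B) $$ (a, a)) = (\<Sum>a<i. \<Sum>c<m. T $$ (a, c) * B $$ (c, a))"
    using T B by (simp add: scalar_prod_def lessThan_atLeast0)
  also have "\<dots> = (\<Sum>c<m. \<Sum>a<i. B $$ (c, a) * T $$ (a, c))"
    by (subst sum.swap) (simp add: mult_ac)
  also have "\<dots> = (\<Sum>c<m. (B * T) $$ (c, c))"
    using T B by (simp add: scalar_prod_def lessThan_atLeast0)
  finally have im: "i = m" by (simp add: TB BT)
  have "T \<in> carrier (GL i)" using T B TB BT im by (auto simp: GL_carrier_iff)
  thus ?thesis using im tw unfolding equivalent_reps_def by metis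
qed

section \<open>Equivalence of representations is an equivalence relation\<close>

lemma equivalent_reps_refl:
  assumes "\<rho> \<in> hom G (GL n)"
  shows "equivalent_reps G n \<rho> \<rho>"
  unfolding equivalent_reps_def
proof (intro bexI ballI)
  show "1\<^sub>m n * \<rho> g = \<rho> g * 1\<^sub>m n" if "g \<in> carrier G" for g
    using rep_carrier[OF assms that] by simp
  show "1\<^sub>m n \<in> carrier (GL n)" by (auto simp: GL_carrier_iff intro!: bexI[of _ "1\<^sub>m n"])
qed

lemma equivalent_reps_sym:
  assumes r: "\<rho> \<in> hom G (GL n)" and s: "\<sigma> \<in> hom G (GL n)" and e: "equivalent_reps G n \<rho> \<sigma>"
  shows "equivalent_reps G n \<sigma> \<rho>"
proof -
  obtain P where "P \<in> carrier (GL n)" and tw: "\<And>g. g \<in> carrier G \<Longrightarrow> P * \<rho> g = \<sigma> g * P"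
    using e unfolding equivalent_reps_def by blast
  then obtain Q where P: "P \<in> carrier_mat n n" and Q: "Q \<in> carrier_mat n n"
    and PQ: "P * Q = 1\<^sub>m n" "Q * P = 1\<^sub>m n"
    unfolding GL_carrier_iff by blast
  have "Q * \<sigma> g = \<rho> g * Q" if g: "g \<in> carrier G" for g
  proof -
    note c = rep_carrier[OF r g] rep_carrier[OF s g]
    have "Q * \<sigma> g = Q * (\<sigma> g * P) * Q"
      using P Q c by (simp add: assoc_mult_mat[of _ n n _ n _ n] PQ)
    also have "\<dots> = Q * (P * \<rho> g) * Q" by (simp add: tw[OF g])
    also have "\<dots> = (Q * P) * \<rho> g * Q" using P Q c by (simp add: assoc_mult_mat[of _ n n _ n _ n])
    finally show ?thesis using c by (simp add: PQ)
  qed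
  moreover have "Q \<in> carrier (GL n)" using P Q PQ by (auto simp: GL_carrier_iff)
  ultimately show ?thesis unfolding equivalent_reps_def by blast
qed

lemma equivalent_reps_trans:
  fixes G (structure)
  assumes r: "\<rho> \<in> hom G (GL n)" and s: "\<sigma> \<in> hom G (GL n)" and t: "\<tau> \<in> hom G (GL n)"
    and e: "equivalent_reps G n \<rho> \<sigma>" "equivalent_reps G n \<sigma> \<tau>"
  shows "equivalent_reps G n \<rho> \<tau>"
proof -
  obtain P where P: "P \<in> carrier (GL n)" and p: "\<And>g. g \<in> carrier G \<Longrightarrow> P * \<rho> g = \<sigma> g * P"
    using e unfolding equivalent_reps_def by blast
  obtain Q where Q: "Q \<in> carrier (GL n)" and q: "\<And>g. g \<in> carrier G \<Longrightarrow> Q * \<sigma> g = \<tau> g * Q"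
    using e unfolding equivalent_reps_def by blast
  have QP: "Q * P \<in> carrier (GL n)"
    using monoid.m_closed[OF group.is_monoid[OF group_GL] Q P] by simp
  have PQm: "P \<in> carrier_mat n n" "Q \<in> carrier_mat n n" using P Q by (auto simp: GL_carrier_iff)
  have "(Q * P) * \<rho> g = \<tau> g * (Q * P)" if g: "g \<in> carrier G" for g
  proof -
    note c = rep_carrier[OF r g] rep_carrier[OF s g] rep_carrier[OF t g]
    have "(Q * P) * \<rho> g = Q * (\<sigma> g * P)" using PQm c p[OF g] by (simp add: assoc_mult_mat[of _ n n _ n _ n])
    also have "\<dots> = (Q * \<sigma> g) * P" using PQm c by (simp add: assoc_mult_mat[of _ n n _ n _ n])
    also have "\<dots> = \<tau> g * (Q * P)" using PQm c q[OF g] by (simp add: assoc_mult_mat[of _ n n _ n _ n])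
    finally show ?thesis .
  qed
  thus ?thesis using QP unfolding equivalent_reps_def by blast
qed

section \<open>Biorthogonal matrix coefficients bound the number of irreducible
  representations\<close>

text \<open>Biorthogonality makes the functions \<open>u s\<close> linearly independent in the space
  of functions on \<open>A\<close>. Concretely, with more indices than points the padded matrix
  \<open>U\<close> is singular, while \<open>U * V\<close> is diagonal with nonzero diagonal
  entries.\<close>

lemma biorthogonal_card_le:
  fixes u v :: "'s \<Rightarrow> 'x \<Rightarrow> complex"
  assumes "finite A" "finite F"
    and orth: "\<And>s t. s \<in> F \<Longrightarrow> t \<in> F \<Longrightarrow> s \<noteq> t \<Longrightarrow> (\<Sum>x\<in>A. u s x * v t x) = 0"
    and diag: "\<And>s. s \<in> F \<Longrightarrow> (\<Sum>x\<in>A. u s x * v s x) \<noteq> 0"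
  shows "card F \<le> card A"
proof (rule ccontr)
  define N m where "N = card F" and "m = card A"
  assume "\<not> card F \<le> card A"
  hence mN: "m < N" unfolding N_def m_def by simp
  obtain e where e: "bij_betw e {0..<N} F" using ex_bij_betw_nat_finite[OF assms(2)] N_def by blast
  obtain y where y: "bij_betw y {0..<m} A" using ex_bij_betw_nat_finite[OF assms(1)] m_def by blast
  \<comment> \<open>Padding with zeros makes the matrices square, so that determinants apply; column
    \<open>m\<close> of \<open>U\<close> is zero.\<close>
  define U where "U = mat N N (\<lambda>(a, b). if b < m then u (e a) (y b) else 0)"
  define V where "V = mat N N (\<lambda>(b, a). if b < m then v (e a) (y b) else 0)"
  have U: "U \<in> carrier_mat N N" and V: "V \<in> carrier_mat N N" unfolding U_def V_def by auto
  have "U *\<^sub>v unit_vec N m = 0\<^sub>v N"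
    using mN unfolding U_def by (intro eq_vecI) auto
  hence "det U = 0" using det_0_iff_vec_prod_zero[OF U] mN by (metis unit_vec_carrier unit_vec_nonzero)
  hence "det (U * V) = 0" using det_mult[OF U V] by simp
  then obtain w where w: "w \<in> carrier_vec N" "w \<noteq> 0\<^sub>v N" "(U * V) *\<^sub>v w = 0\<^sub>v N"
    using det_0_iff_vec_prod_zero[of "U * V" N] U V by auto
  have UV: "(U * V) $$ (a, b) = (\<Sum>x\<in>A. u (e a) x * v (e b) x)" if "a < N" "b < N" for a b
  proof -
    have "(U * V) $$ (a, b) = (\<Sum>c\<in>{0..<N}. if c < m then u (e a) (y c) * v (e b) (y c) else 0)"
      using that unfolding U_def V_def by (auto simp: scalar_prod_def intro!: sum.cong)
    also have "\<dots> = (\<Sum>c\<in>{0..<m}. u (e a) (y c) * v (e b) (y c))"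
      using mN by (intro sum.mono_neutral_cong_right) auto
    finally show ?thesis using sum.reindex_bij_betw[OF y, of "\<lambda>x. u (e a) x * v (e b) x"] by simp
  qed
  have eF: "e a \<in> F" if "a < N" for a using e that unfolding bij_betw_def by auto
  have "w $ a = 0" if a: "a < N" for a
  proof -
    have "0 = ((U * V) *\<^sub>v w) $ a" using w a by simp
    also have "\<dots> = (\<Sum>b\<in>{0..<N}. (U * V) $$ (a, b) * w $ b)"
      using a w(1) carrier_matD[OF mult_carrier_mat[OF U V]]
      by (simp add: scalar_prod_def del: index_mult_mat assoc_mult_mat_vec)
    also have "\<dots> = (\<Sum>b\<in>{0..<N}. if b = a then (U * V) $$ (a, a) * w $ a else 0)"
    proof (intro sum.cong refl)
      fix b assume b: "b \<in> {0..<N}"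
      have "e a \<noteq> e b" if "b \<noteq> a" using that a b e unfolding bij_betw_def inj_on_def by auto
      thus "(U * V) $$ (a, b) * w $ b = (if b = a then (U * V) $$ (a, a) * w $ a else 0)"
        using orth[OF eF eF, of a b] a b by (auto simp: UV)
    qed
    also have "\<dots> = (U * V) $$ (a, a) * w $ a" using a by simp
    finally show ?thesis using diag[OF eF[OF a]] a by (simp add: UV)
  qed
  hence "w = 0\<^sub>v N" using w(1) by (intro eq_vecI) auto
  thus False using w by simp
qed

text \<open>A pair in \<open>F\<close> consists of a dimension and a representation of that dimension.\<close>

lemma inequivalent_irreps_card_le:
  fixes G (structure)
  assumes G: "group G" and H: "subgroup H G" "finite H"
    and irr: "\<And>s. s \<in> F \<Longrightarrow> irreducible_rep G (fst s) (snd s)"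
    and cover: "\<And>g. g \<in> carrier G \<Longrightarrow> \<exists>h\<in>H. \<forall>s\<in>F. snd s g = snd s h"
    and ineq: "\<And>s t. s \<in> F \<Longrightarrow> t \<in> F \<Longrightarrow> s \<noteq> t \<Longrightarrow> fst s = fst t \<Longrightarrow>
      \<not> equivalent_reps G (fst s) (snd t) (snd s)"
    and F: "finite F"
  shows "card F \<le> card H"
proof -
  interpret group G by (rule G)
  have HG: "h \<in> carrier G" if "h \<in> H" for h using subgroup.mem_carrier[OF H(1) that] .
  have rh: "snd s \<in> hom G (GL (fst s))" and pos: "fst s > 0" if "s \<in> F" for s
    using irr[OF that] unfolding irreducible_rep_def by auto
  have rm: "snd s (g \<otimes> h) $$ (a, b) = (\<Sum>c<fst s. snd s g $$ (a, c) * snd s h $$ (c, b))"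
    if "s \<in> F" "g \<in> carrier G" "h \<in> carrier G" "a < fst s" "b < fst s" for s g h a b
    using that carrier_matD[OF rep_carrier[OF rh]] by (simp add: rep_mult[OF rh] scalar_prod_def lessThan_atLeast0)
  have orth: "(\<Sum>x\<in>H. snd s x $$ (a, 0) * snd t (inv x) $$ (0, b)) = 0"
    if s: "s \<in> F" and t: "t \<in> F" and st: "s \<noteq> t" and a: "a < fst s" and b: "b < fst t" for s t a b
  proof -
    \<comment> \<open>The sum over \<open>H\<close> of the products of \<open>snd s x\<close>, the
      matrix unit at (0, 0), and \<open>snd t (inv x)\<close>. Such a sum intertwines the two
      representations on \<open>H\<close>.\<close>
    define T where "T = mat (fst s) (fst t) (\<lambda>(a, b). \<Sum>x\<in>H. snd s x $$ (a, 0) * snd t (inv x) $$ (0, b))"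
    have T: "T \<in> carrier_mat (fst s) (fst t)" unfolding T_def by simp
    have tw: "snd s h * T = T * snd t h" if h: "h \<in> H" for h
    proof (rule eq_matI)
      note cs = carrier_matD[OF rep_carrier[OF rh[OF s] HG[OF h]]]
        and ct = carrier_matD[OF rep_carrier[OF rh[OF t] HG[OF h]]]
      fix a b assume "a < dim_row (T * snd t h)" "b < dim_col (T * snd t h)"
      hence ab: "a < fst s" "b < fst t" using T ct by auto
      \<comment> \<open>This bijection justifies substituting \<open>inv h \<otimes> y\<close> for
        \<open>x\<close>, which moves \<open>h\<close> from the left factor to the right
        one.\<close>
      have bij: "bij_betw (\<lambda>y. inv h \<otimes> y) H H"
        using h H HG by (intro bij_betw_byWitness[where f' = "\<lambda>y. h \<otimes> y"]) (auto simp: m_assoc[symmetric] subgroup.m_closed subgroup.m_inv_closed)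
      have "(snd s h * T) $$ (a, b) =
          (\<Sum>c<fst s. snd s h $$ (a, c) * (\<Sum>x\<in>H. snd s x $$ (c, 0) * snd t (inv x) $$ (0, b)))"
        using cs ab by (simp add: T_def scalar_prod_def lessThan_atLeast0)
      also have "\<dots> = (\<Sum>x\<in>H. (\<Sum>c<fst s. snd s h $$ (a, c) * snd s x $$ (c, 0)) * snd t (inv x) $$ (0, b))"
        unfolding sum_distrib_left sum_distrib_right by (subst sum.swap) (simp add: mult_ac)
      also have "\<dots> = (\<Sum>x\<in>H. snd s (h \<otimes> x) $$ (a, 0) * snd t (inv x) $$ (0, b))"
        by (intro sum.cong refl) (simp add: rm s h HG ab pos)
      also have "\<dots> = (\<Sum>y\<in>H. snd s (h \<otimes> (inv h \<otimes> y)) $$ (a, 0) * snd t (inv (inv h \<otimes> y)) $$ (0, b))"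
        using sum.reindex_bij_betw[OF bij, of "\<lambda>x. snd s (h \<otimes> x) $$ (a, 0) * snd t (inv x) $$ (0, b)"]
        by simp
      also have "\<dots> = (\<Sum>y\<in>H. snd s y $$ (a, 0) * snd t (inv y \<otimes> h) $$ (0, b))"
        using h HG by (intro sum.cong refl) (simp add: m_assoc[symmetric] inv_mult_group)
      also have "\<dots> = (\<Sum>y\<in>H. snd s y $$ (a, 0) * (\<Sum>c<fst t. snd t (inv y) $$ (0, c) * snd t h $$ (c, b)))"
        by (intro sum.cong refl) (simp add: rm t h HG ab pos)
      also have "\<dots> = (\<Sum>c<fst t. (\<Sum>y\<in>H. snd s y $$ (a, 0) * snd t (inv y) $$ (0, c)) * snd t h $$ (c, b))"
        unfolding sum_distrib_left sum_distrib_right by (subst sum.swap) (simp add: mult_ac)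
      also have "\<dots> = (T * snd t h) $$ (a, b)"
        using ct ab by (simp add: T_def scalar_prod_def lessThan_atLeast0)
      finally show "(snd s h * T) $$ (a, b) = (T * snd t h) $$ (a, b)" .
    qed (use carrier_matD[OF T] carrier_matD[OF rep_carrier[OF rh[OF s] HG[OF h]]] carrier_matD[OF rep_carrier[OF rh[OF t] HG[OF h]]] in simp_all)
    \<comment> \<open>A single element of \<open>H\<close> has the same image as \<open>g\<close>
      under all members of \<open>F\<close>, so the intertwining relation extends from
      \<open>H\<close> to \<open>G\<close>.\<close>
    have "snd s g * T = T * snd t g" if g: "g \<in> carrier G" for g
      using cover[OF g] tw s t by metis
    hence "T = 0\<^sub>m (fst s) (fst t)"
      using irreducible_schur[OF G irr[OF s] irr[OF t] T] ineq[OF s t st] by blast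
    hence "T $$ (a, b) = 0" using a b by simp
    thus ?thesis using a b unfolding T_def by simp
  qed
  \<comment> \<open>Otherwise the (0, 0) entries of \<open>snd s (inv x \<otimes> x)\<close> would
    sum to zero over \<open>H\<close>, although each of them is 1.\<close>
  have "\<exists>a<fst s. (\<Sum>x\<in>H. snd s x $$ (a, 0) * snd s (inv x) $$ (0, a)) \<noteq> 0" if s: "s \<in> F" for s
  proof (rule ccontr)
    assume *: "\<not> ?thesis"
    have "of_nat (card H) = (\<Sum>x\<in>H. snd s (inv x \<otimes> x) $$ (0, 0))"
      using rep_one[OF G rh[OF s]] pos[OF s] HG by simp
    also have "\<dots> = (\<Sum>x\<in>H. \<Sum>a<fst s. snd s (inv x) $$ (0, a) * snd s x $$ (a, 0))"
      using s pos[OF s] HG by (intro sum.cong refl rm) auto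
    also have "\<dots> = (\<Sum>a<fst s. \<Sum>x\<in>H. snd s x $$ (a, 0) * snd s (inv x) $$ (0, a))"
      by (subst sum.swap) (simp add: mult_ac)
    also have "\<dots> = 0" using * by (intro sum.neutral) auto
    finally show False using H subgroup.one_closed[OF H(1)] by auto
  qed
  hence "\<forall>s\<in>F. \<exists>a. a < fst s \<and> (\<Sum>x\<in>H. snd s x $$ (a, 0) * snd s (inv x) $$ (0, a)) \<noteq> 0"
    by blast
  from bchoice[OF this] obtain \<alpha> where \<alpha>: "\<forall>s\<in>F. \<alpha> s < fst s \<and>
    (\<Sum>x\<in>H. snd s x $$ (\<alpha> s, 0) * snd s (inv x) $$ (0, \<alpha> s)) \<noteq> 0" ..
  show ?thesis
  proof (rule biorthogonal_card_le[OF H(2) F])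
    show "(\<Sum>x\<in>H. snd s x $$ (\<alpha> s, 0) * snd t (inv x) $$ (0, \<alpha> t)) = 0"
      if "s \<in> F" "t \<in> F" "s \<noteq> t" for s t
      by (rule orth[OF that]) (use \<alpha> that in auto)
    show "(\<Sum>x\<in>H. snd s x $$ (\<alpha> s, 0) * snd s (inv x) $$ (0, \<alpha> s)) \<noteq> 0" if "s \<in> F" for s
      using \<alpha> that by blast
  qed
qed

lemma finite_card_le_if_finite_subsets:
  assumes "\<And>B. B \<subseteq> A \<Longrightarrow> finite B \<Longrightarrow> card B \<le> n"
  shows "finite A \<and> card A \<le> n"
proof -
  have "finite A"
  proof (rule ccontr)
    assume "infinite A"
    then obtain B where "finite B" "card B = Suc n" "B \<subseteq> A"
      using infinite_arbitrarily_large by blast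
    thus False using assms[of B] by simp
  qed
  thus ?thesis using assms by blast
qed

text \<open>All dimensions up to \<open>n\<close> are treated at once: representatives of the
  classes, paired with their dimensions, form a family to which the bound for inequivalent
  irreducible representations applies. The hypothesis \<open>cover\<close> says that modulo the
  common kernel of these representations every element of \<open>G\<close> comes from
  \<open>H\<close>.\<close>

lemma R_irr_le_card:
  assumes G: "group G" and H: "subgroup H G" "finite H"
    and cover: "\<And>g. g \<in> carrier G \<Longrightarrow>
      \<exists>h\<in>H. \<forall>i\<in>{1..n}. \<forall>\<rho>\<in>finite_index_irreps G i. \<rho> g = \<rho> h"
  shows "R_irr G n \<le> enat (card H)"
proof -
  define rel where "rel i = {(\<rho>, \<sigma>) \<in> finite_index_irreps G i \<times> finite_index_irreps G i.
    equivalent_reps G i \<rho> \<sigma>}" for i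
  have hom: "\<rho> \<in> hom G (GL i)" and irr: "irreducible_rep G i \<rho>" if "\<rho> \<in> finite_index_irreps G i" for \<rho> i
    using that unfolding finite_index_irreps_def irreducible_rep_def by auto
  have eq: "equiv (finite_index_irreps G i) (rel i)" for i
  proof (rule equivI)
    show "rel i \<subseteq> finite_index_irreps G i \<times> finite_index_irreps G i" unfolding rel_def by auto
    show "refl_on (finite_index_irreps G i) (rel i)"
      unfolding rel_def refl_on_def using equivalent_reps_refl[OF hom] by auto
    show "sym (rel i)"
      unfolding rel_def sym_def using equivalent_reps_sym[OF hom hom] by auto
    show "trans (rel i)"
      unfolding rel_def trans_def using equivalent_reps_trans[OF hom hom hom] by blast
  qed
  have ic: "irrep_classes G i = finite_index_irreps G i // rel i" for i
    unfolding irrep_classes_def rel_def ..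
  \<comment> \<open>The disjoint union of the sets of classes over all dimensions. Its finite
    subsets are bounded first, which yields its finiteness and so rules out infinite values of
    \<open>r_irr\<close>.\<close>
  define C where "C = Sigma {1..n} (irrep_classes G)"
  have "card B \<le> card H" if B: "B \<subseteq> C" "finite B" for B
  proof -
    define r where "r b = (fst b, SOME \<rho>. \<rho> \<in> snd b)" for b :: "nat \<times> ('a \<Rightarrow> complex mat) set"
    have cl: "fst b \<in> {1..n}" "snd b \<in> finite_index_irreps G (fst b) // rel (fst b)" if "b \<in> B" for b
      using B that unfolding C_def ic by auto
    have rin: "snd (r b) \<in> snd b" if "b \<in> B" for b
      using in_quotient_imp_non_empty[OF eq cl(2)[OF that]] unfolding r_def by (simp add: some_in_eq)
    have rfi: "snd (r b) \<in> finite_index_irreps G (fst b)" if "b \<in> B" for b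
      using in_quotient_imp_subset[OF eq cl(2)[OF that]] rin[OF that] by blast
    have same: "b = c" if bc: "b \<in> B" "c \<in> B" "fst b = fst c"
      "equivalent_reps G (fst b) (snd (r b)) (snd (r c))" for b c
    proof -
      have "(snd (r b), snd (r c)) \<in> rel (fst b)"
        using bc rfi[OF bc(1)] rfi[OF bc(2)] unfolding rel_def by auto
      hence "snd b = snd c"
        using quotient_eqI[OF eq cl(2)[OF bc(1)] _ rin[OF bc(1)] rin[OF bc(2)]] cl(2)[OF bc(2)] bc(3) by simp
      thus ?thesis using bc(3) by (simp add: prod_eq_iff)
    qed
    have fr: "fst (r b) = fst b" for b unfolding r_def by simp
    have inj: "inj_on r B"
    proof (rule inj_onI)
      fix b c assume bc: "b \<in> B" "c \<in> B" "r b = r c"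
      hence "fst b = fst c" by (metis fr)
      thus "b = c" using same[OF bc(1,2)] bc equivalent_reps_refl[OF hom[OF rfi[OF bc(1)]]] by simp
    qed
    have "card (r ` B) \<le> card H"
    proof (rule inequivalent_irreps_card_le[OF G H])
      show "irreducible_rep G (fst s) (snd s)" if "s \<in> r ` B" for s
        using that irr[OF rfi] by (auto simp: fr)
      show "\<exists>h\<in>H. \<forall>s\<in>r ` B. snd s g = snd s h" if g: "g \<in> carrier G" for g
      proof -
        obtain h where h: "h \<in> H" "\<forall>i\<in>{1..n}. \<forall>\<rho>\<in>finite_index_irreps G i. \<rho> g = \<rho> h"
          using cover[OF g] by blast
        have "snd (r b) g = snd (r b) h" if "b \<in> B" for b
          using h(2) cl(1)[OF that] rfi[OF that] by blast
        thus ?thesis using h(1) by blast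
      qed
      show "\<not> equivalent_reps G (fst s) (snd t) (snd s)"
        if st: "s \<in> r ` B" "t \<in> r ` B" "s \<noteq> t" "fst s = fst t" for s t
      proof
        assume e: "equivalent_reps G (fst s) (snd t) (snd s)"
        obtain b c where bc: "b \<in> B" "c \<in> B" "s = r b" "t = r c" using st(1,2) by blast
        have f: "fst c = fst b" using st(4) bc(3,4) by (simp only: fr)
        have "equivalent_reps G (fst c) (snd (r c)) (snd (r b))"
          using e unfolding bc(3,4) fr f .
        from same[OF bc(2,1) f this] show False using st(3) bc(3,4) by simp
      qed
    qed (use B in auto)
    thus ?thesis using card_image[OF inj] by simp
  qed
  hence C: "finite C" "card C \<le> card H" using finite_card_le_if_finite_subsets[of C "card H"] by auto
  have fin: "finite (irrep_classes G i)" if "i \<in> {1..n}" for i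
  proof -
    have "irrep_classes G i \<subseteq> snd ` C" using that unfolding C_def by force
    thus ?thesis using C(1) finite_subset by blast
  qed
  have "R_irr G n = (\<Sum>i = 1..n. enat (card (irrep_classes G i)))"
    unfolding R_irr_def r_irr_def using fin by (intro sum.cong) auto
  also have "\<dots> = enat (\<Sum>i = 1..n. card (irrep_classes G i))"
    using of_nat_sum[of "\<lambda>i. card (irrep_classes G i)" "{1..n}", where 'a = enat]
    by (simp add: of_nat_eq_enat)
  also have "(\<Sum>i = 1..n. card (irrep_classes G i)) = card C"
    unfolding C_def using fin by simp
  finally show ?thesis using C(2) by simp
qed

section \<open>Representations whose kernel has finite index\<close>

lemma rep_pow:
  fixes G (structure)
  assumes "group G" "\<rho> \<in> hom G (GL i)" "y \<in> carrier G"
  shows "\<rho> (y [^] (k::nat)) = \<rho> y ^\<^sub>m k"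
proof (induction k)
  case 0
  thus ?case using rep_one[OF assms(1,2)] rep_carrier[OF assms(2,3)] by simp
next
  case (Suc k)
  interpret group G by fact
  show ?case using Suc rep_mult[OF assms(2) nat_pow_closed[OF assms(3), of k] assms(3)] by simp
qed

text \<open>Two distinct powers of \<open>y\<close> lie in the same coset of the kernel, as there
  are only finitely many cosets; their quotient is a power of \<open>y\<close> in the
  kernel.\<close>

lemma rep_finite_order:
  fixes G (structure)
  assumes G: "group G" and \<rho>: "\<rho> \<in> hom G (GL i)" and fin: "finite (rcosets (kernel G (GL i) \<rho>))"
    and y: "y \<in> carrier G"
  obtains N where "N > 0" "\<rho> y ^\<^sub>m N = 1\<^sub>m i"
proof -
  interpret group G by (rule G)
  define K where "K = kernel G (GL i) \<rho>"
  have K: "subgroup K G"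
    unfolding K_def using group_hom.subgroup_kernel[of G "GL i" \<rho>] G group_GL \<rho>
    by (simp add: group_hom_def group_hom_axioms_def)
  define f where "f k = K #> (y [^] k)" for k :: nat
  have "range f \<subseteq> rcosets K" unfolding f_def RCOSETS_def using y by auto
  hence "finite (range f)" using fin unfolding K_def by (rule finite_subset)
  hence "\<not> inj f" using finite_imageD infinite_UNIV_nat by blast
  then obtain a b where ab: "a < b" "f a = f b"
    unfolding inj_def by (metis linorder_neqE_nat)
  have "y [^] b \<in> K #> (y [^] a)"
    using rcos_self[OF _ K, of "y [^] b"] y ab(2)
    unfolding f_def by simp
  then obtain k where k: "k \<in> K" "y [^] b = k \<otimes> y [^] a" unfolding r_coset_def by auto
  have kG: "k \<in> carrier G" and \<rho>k: "\<rho> k = 1\<^sub>m i" using k(1) unfolding K_def kernel_def by auto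
  have "k = y [^] (b - a)"
  proof -
    have "y [^] (b - a) \<otimes> y [^] a = y [^] b" using ab y by (simp add: nat_pow_mult)
    thus ?thesis using k(2) kG y by (metis nat_pow_closed right_cancel)
  qed
  hence "\<rho> y ^\<^sub>m (b - a) = 1\<^sub>m i" using rep_pow[OF G \<rho> y, of "b - a"] \<rho>k by simp
  thus ?thesis using that[of "b - a"] ab by simp
qed

text \<open>The relation passes to \<open>\<rho> y\<close>, so its eigenvalues are roots of unity of
  bounded order, and finite order turns this into a statement about the matrix itself. The exponent
  is the same for all \<open>\<rho>\<close> of dimension at most \<open>n\<close> and all such
  \<open>y\<close>.\<close>

lemma rep_trivial_of_conjugate_power:
  fixes G (structure)
  assumes G: "group G" and \<rho>: "\<rho> \<in> hom G (GL i)" and fin: "finite (rcosets (kernel G (GL i) \<rho>))"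
    and y: "y \<in> carrier G" and t: "t \<in> carrier G" and rel: "t \<otimes> y [^] q = y \<otimes> t"
    and q: "q > (1::nat)" and "i \<le> n"
  shows "\<rho> (y [^] (fact (q ^ n) :: nat)) = 1\<^sub>m i"
proof -
  interpret group G by (rule G)
  obtain N where N: "N > 0" "\<rho> y ^\<^sub>m N = 1\<^sub>m i" using rep_finite_order[OF G \<rho> fin y] .
  note Y = rep_carrier[OF \<rho> y] and P = rep_carrier[OF \<rho> t] and Q = rep_carrier[OF \<rho> inv_closed[OF t]]
  have QP: "\<rho> (inv t) * \<rho> t = 1\<^sub>m i"
    using rep_mult[OF \<rho> inv_closed[OF t] t] t rep_one[OF G \<rho>] by simp
  have PY: "\<rho> t * \<rho> y ^\<^sub>m q = \<rho> y * \<rho> t"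
    using rep_mult[OF \<rho> t nat_pow_closed[OF y], of q] rep_mult[OF \<rho> y t] rel rep_pow[OF G \<rho> y] by simp
  have "l ^ fact (q ^ n) = 1" if ev: "eigenvalue (\<rho> y) l" for l
  proof -
    obtain v where v: "eigenvector (\<rho> y) v l" using ev unfolding eigenvalue_def by blast
    hence vc: "v \<in> carrier_vec i" "v \<noteq> 0\<^sub>v i" using Y unfolding eigenvector_def by auto
    \<comment> \<open>A zero eigenvalue is impossible, since \<open>\<rho> y\<close> has finite
      positive order \<open>N\<close>.\<close>
    have "v = l ^ N \<cdot>\<^sub>v v" using eigenvector_pow[OF Y v, of N] N vc by simp
    moreover have "0 \<cdot>\<^sub>v v = 0\<^sub>v i" using vc(1) by (intro eq_vecI) auto
    ultimately have "l \<noteq> 0" using vc N(1) by (metis zero_power)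
    thus ?thesis using eigenvalues_roots_of_unity[OF Y P Q QP PY q \<open>i \<le> n\<close> ev] by blast
  qed
  thus ?thesis unfolding rep_pow[OF G \<rho> y] by (rule pow_mat_fourier[OF Y N])
qed

section \<open>Products of groups generated by unipotents\<close>

lemma (in group) pow_eq_of_cong:
  assumes a: "a \<in> carrier G" "a [^] (p::nat) = \<one>" and "[k = l] (mod p)"
  shows "a [^] k = a [^] (l::nat)"
proof -
  have "a [^] k = a [^] (k mod p)" for k :: nat
  proof -
    have "a [^] (p * (k div p) + k mod p) = (a [^] p) [^] (k div p) \<otimes> a [^] (k mod p)"
      using a(1) by (simp add: nat_pow_mult nat_pow_pow)
    thus ?thesis using a by simp
  qed
  from this[of k] this[of l] show ?thesis using assms(3) by (simp add: cong_def)
qed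

text \<open>Lets one element \<open>u\<close> conjugate every power of \<open>z\<close>; in the
  product the exponent \<open>m\<close> will vary with the factor. It holds since conjugation by
  \<open>u\<close> is multiplicative.\<close>

lemma (in group) conjugate_pow:
  assumes u: "u \<in> carrier G" and z: "z \<in> carrier G" and rel: "u \<otimes> z [^] q = z \<otimes> u"
  shows "u \<otimes> (z [^] m) [^] (q::nat) = z [^] (m::nat) \<otimes> u"
proof (induction m)
  case (Suc m)
  have "u \<otimes> (z [^] Suc m) [^] q = u \<otimes> ((z [^] m) [^] q \<otimes> z [^] q)"
    using nat_pow_pow[OF z, of "Suc m" q] nat_pow_pow[OF z, of m q] nat_pow_mult[OF z, of "m * q" q]
    by (simp add: add.commute del: nat_pow_Suc)
  also have "\<dots> = (u \<otimes> (z [^] m) [^] q) \<otimes> z [^] q" using u z by (simp add: m_assoc)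
  also have "\<dots> = z [^] m \<otimes> (u \<otimes> z [^] q)" using Suc u z by (simp add: m_assoc)
  also have "\<dots> = z [^] Suc m \<otimes> u" using rel u z by (simp add: m_assoc)
  finally show ?case .
qed (use u in simp)

section \<open>A product of finite groups as a profinite group\<close>

locale finite_group_family =
  fixes S :: "nat \<Rightarrow> 'a monoid"
  assumes grp: "group (S j)" and fin: "finite (carrier (S j))"
begin

abbreviation "G \<equiv> product_group UNIV S"

abbreviation "T \<equiv> product_topology (\<lambda>j. discrete_topology (carrier (S j))) UNIV"

sublocale G: group G
  using grp by simp

lemma carrier_iff: "f \<in> carrier G \<longleftrightarrow> (\<forall>j. f j \<in> carrier (S j))"
  by (auto simp: PiE_iff)

lemma mult_apply: "(f \<otimes>\<^bsub>G\<^esub> g) j = f j \<otimes>\<^bsub>S j\<^esub> g j"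
  by simp

lemma pow_apply: "(f [^]\<^bsub>G\<^esub> (k::nat)) j = f j [^]\<^bsub>S j\<^esub> k"
  by (induction k) simp_all

text \<open>Compactness is Tychonoff's theorem; the other properties reduce to single coordinates,
  where the space is discrete.\<close>

lemma profinite_group_product: "profinite_group G T"
proof -
  have proj: "continuous_map T (discrete_topology (carrier (S j))) (\<lambda>f. f j)" for j
    by (rule continuous_map_product_projection) simp
  have "continuous_map (prod_topology T T) (discrete_topology (carrier (S j)))
      (\<lambda>z. (case z of (f, g) \<Rightarrow> f \<otimes>\<^bsub>G\<^esub> g) j)" for j
  proof -
    interpret Sj: group "S j" by (rule grp)
    let ?D = "discrete_topology (carrier (S j))"
    have 1: "continuous_map (prod_topology T T) (prod_topology ?D ?D) (\<lambda>z. (fst z j, snd z j))"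
      by (intro continuous_map_pairedI continuous_map_compose[OF continuous_map_fst proj, unfolded o_def]
          continuous_map_compose[OF continuous_map_snd proj, unfolded o_def])
    have 2: "continuous_map (prod_topology ?D ?D) ?D (\<lambda>(a, b). a \<otimes>\<^bsub>S j\<^esub> b)"
      unfolding prod_topology_discrete_topology[symmetric]
      by (auto simp: continuous_map_from_discrete_topology)
    show ?thesis
      using continuous_map_compose[OF 1 2] by (simp add: o_def case_prod_beta)
  qed
  hence mult: "continuous_map (prod_topology T T) T (\<lambda>(f, g). f \<otimes>\<^bsub>G\<^esub> g)"
    unfolding continuous_map_componentwise_UNIV by blast
  have "continuous_map T (discrete_topology (carrier (S j))) (\<lambda>f. (inv\<^bsub>G\<^esub> f) j)" for j
  proof -
    interpret Sj: group "S j" by (rule grp)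
    have "continuous_map (discrete_topology (carrier (S j))) (discrete_topology (carrier (S j))) (\<lambda>a. inv\<^bsub>S j\<^esub> a)"
      by (auto simp: continuous_map_from_discrete_topology)
    from continuous_map_compose[OF proj this]
    have "continuous_map T (discrete_topology (carrier (S j))) (\<lambda>f. inv\<^bsub>S j\<^esub> (f j))"
      by (simp add: o_def)
    thus ?thesis
      by (rule continuous_map_eq) (use inv_product_group[of _ UNIV S] grp in auto)
  qed
  hence inv: "continuous_map T T (\<lambda>f. inv\<^bsub>G\<^esub> f)"
    unfolding continuous_map_componentwise_UNIV by blast
  have "totally_disconnected T"
    unfolding totally_disconnected_def
  proof (intro allI impI)
    fix A assume A: "connectedin T A"
    have "f = g" if "f \<in> A" "g \<in> A" for f g
    proof
      fix j
      have "connectedin (discrete_topology (carrier (S j))) ((\<lambda>f. f j) ` A)"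
        by (rule connectedin_continuous_map_image[OF proj A])
      then obtain a where "(\<lambda>f. f j) ` A \<subseteq> {a}" by (auto simp: connectedin_discrete_topology)
      thus "f j = g j" using that by blast
    qed
    thus "\<exists>x. A \<subseteq> {x}" by blast
  qed
  moreover have "compact_space T"
    using fin by (auto simp: compact_space_product_topology compact_space_discrete_topology)
  moreover have "Hausdorff_space T"
    by (auto simp: Hausdorff_space_product_topology)
  ultimately show ?thesis
    unfolding profinite_group_def topological_group_def using mult inv G.is_group by auto
qed

end

section \<open>Density of two generators and triviality of representations on a tail\<close>

text \<open>Abstracts what is used about the factors: \<open>x j\<close> and \<open>y j\<close> are
  the unipotent generators, \<open>s j\<close> and \<open>t j\<close> the diagonal matrices
  conjugating their fourth powers back to them. In \<open>gen\<close> the word length four is the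
  same for all \<open>j\<close>; hence an element of the infinite product is a product of four
  sequences of unipotents.\<close>

locale unipotent_family = finite_group_family S for S :: "nat \<Rightarrow> 'a monoid" +
  fixes p :: "nat \<Rightarrow> nat" and x y s t :: "nat \<Rightarrow> 'a"
  assumes prime_p: "prime (p j)" and inj_p: "inj p"
    and x: "x j \<in> carrier (S j)" "x j [^]\<^bsub>S j\<^esub> p j = \<one>\<^bsub>S j\<^esub>" "x j \<noteq> \<one>\<^bsub>S j\<^esub>"
    and y: "y j \<in> carrier (S j)" "y j [^]\<^bsub>S j\<^esub> p j = \<one>\<^bsub>S j\<^esub>"
    and s: "s j \<in> carrier (S j)" "s j \<otimes>\<^bsub>S j\<^esub> x j [^]\<^bsub>S j\<^esub> (4::nat) = x j \<otimes>\<^bsub>S j\<^esub> s j"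
    and t: "t j \<in> carrier (S j)" "t j \<otimes>\<^bsub>S j\<^esub> y j [^]\<^bsub>S j\<^esub> (4::nat) = y j \<otimes>\<^bsub>S j\<^esub> t j"
    and gen: "g \<in> carrier (S j) \<Longrightarrow> \<exists>(a::nat) (b::nat) (c::nat) (d::nat). g = x j [^]\<^bsub>S j\<^esub> a \<otimes>\<^bsub>S j\<^esub>
      (y j [^]\<^bsub>S j\<^esub> b \<otimes>\<^bsub>S j\<^esub> (x j [^]\<^bsub>S j\<^esub> c \<otimes>\<^bsub>S j\<^esub> y j [^]\<^bsub>S j\<^esub> d))"
begin

lemma infinite_carrier: "infinite (carrier G)"
proof
  assume "finite (carrier G)"
  \<comment> \<open>The elements equal to \<open>x i\<close> in coordinate \<open>i\<close> and
    trivial elsewhere are pairwise distinct.\<close>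
  moreover have "inj (\<lambda>i j. if j = i then x j else \<one>\<^bsub>S j\<^esub>)"
    using x(3) by (auto simp: inj_def fun_eq_iff)
  moreover have "range (\<lambda>i j. if j = i then x j else \<one>\<^bsub>S j\<^esub>) \<subseteq> carrier G"
    using x(1) monoid.one_closed[OF group.is_monoid[OF grp]] by (auto simp: PiE_iff)
  ultimately show False using finite_subset finite_imageD infinite_UNIV_nat by blast
qed

lemma unipotent_coordinates:
  assumes g: "g \<in> carrier G"
  shows "\<exists>(a::nat \<Rightarrow> nat) (b::nat \<Rightarrow> nat) (c::nat \<Rightarrow> nat) (d::nat \<Rightarrow> nat). \<forall>j. g j = x j [^]\<^bsub>S j\<^esub> a j \<otimes>\<^bsub>S j\<^esub>
      (y j [^]\<^bsub>S j\<^esub> b j \<otimes>\<^bsub>S j\<^esub> (x j [^]\<^bsub>S j\<^esub> c j \<otimes>\<^bsub>S j\<^esub> y j [^]\<^bsub>S j\<^esub> d j))"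
proof -
  have "\<forall>j. \<exists>q :: nat \<times> nat \<times> nat \<times> nat. case q of (a, b, c, d) \<Rightarrow> g j = x j [^]\<^bsub>S j\<^esub> a \<otimes>\<^bsub>S j\<^esub>
      (y j [^]\<^bsub>S j\<^esub> b \<otimes>\<^bsub>S j\<^esub> (x j [^]\<^bsub>S j\<^esub> c \<otimes>\<^bsub>S j\<^esub> y j [^]\<^bsub>S j\<^esub> d))"
    using gen g unfolding carrier_iff by simp
  then obtain q :: "nat \<Rightarrow> nat \<times> nat \<times> nat \<times> nat" where "\<And>j. case q j of (a, b, c, d) \<Rightarrow> g j = x j [^]\<^bsub>S j\<^esub> a \<otimes>\<^bsub>S j\<^esub>
      (y j [^]\<^bsub>S j\<^esub> b \<otimes>\<^bsub>S j\<^esub> (x j [^]\<^bsub>S j\<^esub> c \<otimes>\<^bsub>S j\<^esub> y j [^]\<^bsub>S j\<^esub> d))"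
    by (rule choice[THEN exE]) blast
  hence *: "\<forall>j. g j = x j [^]\<^bsub>S j\<^esub> fst (q j) \<otimes>\<^bsub>S j\<^esub> (y j [^]\<^bsub>S j\<^esub> fst (snd (q j)) \<otimes>\<^bsub>S j\<^esub>
      (x j [^]\<^bsub>S j\<^esub> fst (snd (snd (q j))) \<otimes>\<^bsub>S j\<^esub> y j [^]\<^bsub>S j\<^esub> snd (snd (snd (q j)))))"
    by (simp add: case_prod_beta)
  show ?thesis by (rule exI, rule exI, rule exI, rule exI, rule *)
qed

lemma coprime_p: "i \<noteq> j \<Longrightarrow> coprime (p i) (p j)"
  using primes_coprime[OF prime_p prime_p] inj_p by (metis injD)

text \<open>A basic open set constrains only a finite set \<open>F\<close> of coordinates. There the
  four exponents, which depend on the coordinate, can be replaced by common ones, because the moduli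
  \<open>p j\<close> are distinct primes.\<close>

lemma topologically_finitely_generated_product: "topologically_finitely_generated G T"
proof -
  have xyG: "x \<in> carrier G" "y \<in> carrier G" using x y by (auto simp: carrier_iff)
  have sub: "subgroup (generate G {x, y}) G" using xyG by (intro G.generate_is_subgroup) auto
  have "g \<in> T closure_of (generate G {x, y})" if g: "g \<in> topspace T" for g
    unfolding in_closure_of
  proof (intro conjI allI impI)
    fix U assume U: "g \<in> U \<and> openin T U"
    then obtain V where fV: "finite {j \<in> UNIV. V j \<noteq> topspace (discrete_topology (carrier (S j)))}"
      and gV: "g \<in> Pi\<^sub>E UNIV V" and VU: "Pi\<^sub>E UNIV V \<subseteq> U"
      unfolding openin_product_topology_alt by blast
    define F where "F = {j. V j \<noteq> carrier (S j)}"
    have F: "finite F" using fV unfolding F_def by simp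
    have gG: "g \<in> carrier G" using g by simp
    obtain a b c d :: "nat \<Rightarrow> nat" where co: "\<forall>j. g j = x j [^]\<^bsub>S j\<^esub> a j \<otimes>\<^bsub>S j\<^esub>
      (y j [^]\<^bsub>S j\<^esub> b j \<otimes>\<^bsub>S j\<^esub> (x j [^]\<^bsub>S j\<^esub> c j \<otimes>\<^bsub>S j\<^esub> y j [^]\<^bsub>S j\<^esub> d j))"
      using unipotent_coordinates[OF gG] by (elim exE) (rule that)
    have crt: "\<exists>k. \<forall>j\<in>F. [k = e j] (mod p j)" for e
      using chinese_remainder_nat[OF F, of p e] coprime_p by blast
    obtain a' where a': "\<forall>j\<in>F. [a' = a j] (mod p j)" using crt by blast
    obtain b' where b': "\<forall>j\<in>F. [b' = b j] (mod p j)" using crt by blast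
    obtain c' where c': "\<forall>j\<in>F. [c' = c j] (mod p j)" using crt by blast
    obtain d' where d': "\<forall>j\<in>F. [d' = d j] (mod p j)" using crt by blast
    define w where "w = x [^]\<^bsub>G\<^esub> a' \<otimes>\<^bsub>G\<^esub> (y [^]\<^bsub>G\<^esub> b' \<otimes>\<^bsub>G\<^esub> (x [^]\<^bsub>G\<^esub> c' \<otimes>\<^bsub>G\<^esub> y [^]\<^bsub>G\<^esub> d'))"
    have pw: "z [^]\<^bsub>G\<^esub> (k::nat) \<in> generate G {x, y}" if "z \<in> {x, y}" for z k
    proof (induction k)
      case (Suc k)
      thus ?case using generate.eng[OF Suc generate.incl[OF that]] by (simp del: mult_product_group)
    qed (simp add: generate.one del: one_product_group)
    have w: "w \<in> generate G {x, y}" unfolding w_def by (intro generate.eng pw) auto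
    have wG: "w \<in> carrier G" using subgroup.mem_carrier[OF sub w] .
    have "w j = g j" if j: "j \<in> F" for j
    proof -
      interpret Sj: group "S j" by (rule grp)
      note xe = Sj.pow_eq_of_cong[OF x(1,2)] and ye = Sj.pow_eq_of_cong[OF y]
      show ?thesis
        unfolding w_def mult_apply pow_apply co[rule_format, of j]
        using xe[OF a'[rule_format, OF j]] ye[OF b'[rule_format, OF j]]
          xe[OF c'[rule_format, OF j]] ye[OF d'[rule_format, OF j]] by simp
    qed
    moreover have "w j \<in> V j" if "j \<notin> F" for j
      using that wG unfolding F_def carrier_iff by simp
    moreover have "g j \<in> V j" for j using gV by (simp add: PiE_iff)
    ultimately have "w j \<in> V j" for j by (cases "j \<in> F") (simp_all only:)
    hence "w \<in> Pi\<^sub>E UNIV V" by (simp add: PiE_iff)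
    thus "\<exists>w. w \<in> generate G {x, y} \<and> w \<in> U" using w VU by blast
  qed (use g in simp)
  hence "T closure_of (generate G {x, y}) = topspace T"
    using closure_of_subset_topspace[of T "generate G {x, y}"] by (intro equalityI subsetI) auto
  thus ?thesis unfolding topologically_finitely_generated_def using xyG by (intro exI[of _ "{x, y}"]) simp
qed

text \<open>The given element is a \<open>D\<close>-th power of another tail element
  \<open>v\<close>, and \<open>u\<close> conjugates the fourth power of \<open>v\<close> to
  \<open>v\<close>; so \<open>\<rho>\<close> kills the \<open>D\<close>-th power of
  \<open>v\<close>.\<close>

lemma rep_trivial_on_tail_unipotent:
  assumes \<rho>: "\<rho> \<in> hom G (GL i)" "finite (rcosets\<^bsub>G\<^esub> (kernel G (GL i) \<rho>))" "i \<le> n"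
    and k: "\<And>j. k \<le> j \<Longrightarrow> 4 ^ n < p j"
    and z: "\<And>j. z j \<in> carrier (S j)" "\<And>j. z j [^]\<^bsub>S j\<^esub> p j = \<one>\<^bsub>S j\<^esub>"
    and u: "\<And>j. u j \<in> carrier (S j)" "\<And>j. u j \<otimes>\<^bsub>S j\<^esub> z j [^]\<^bsub>S j\<^esub> (4::nat) = z j \<otimes>\<^bsub>S j\<^esub> u j"
  shows "\<rho> (\<lambda>j. if k \<le> j then z j [^]\<^bsub>S j\<^esub> (e j :: nat) else \<one>\<^bsub>S j\<^esub>) = 1\<^sub>m i"
proof -
  define D :: nat where "D = fact (4 ^ n)"
  \<comment> \<open>The prime \<open>p j\<close> exceeds \<open>4 ^ n\<close> and so does not divide
    the factorial \<open>D\<close>; hence \<open>e j\<close> can be divided by \<open>D\<close>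
    modulo \<open>p j\<close>.\<close>
  have "\<exists>m. [m * D = e j] (mod p j)" if "k \<le> j" for j
  proof -
    have "\<not> p j dvd D" using prime_dvd_fact_iff[OF prime_p[of j], of "4 ^ n"] k[OF that]
      unfolding D_def by simp
    hence "coprime D (p j)" using prime_imp_coprime[OF prime_p] by (simp add: coprime_commute)
    then obtain r where r: "[D * r = 1] (mod p j)" using cong_solve_coprime_nat[of D "p j"] by auto
    have "[e j * (D * r) = e j * 1] (mod p j)" by (intro cong_mult cong_refl r)
    thus ?thesis by (intro exI[of _ "e j * r"]) (simp add: mult_ac)
  qed
  then obtain m where m: "\<And>j. k \<le> j \<Longrightarrow> [m j * D = e j] (mod p j)" by metis
  define v where "v = (\<lambda>j. if k \<le> j then z j [^]\<^bsub>S j\<^esub> m j else \<one>\<^bsub>S j\<^esub>)"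
  have v: "v \<in> carrier G" unfolding carrier_iff v_def
    using monoid.nat_pow_closed[OF group.is_monoid[OF grp] z(1)] monoid.one_closed[OF group.is_monoid[OF grp]]
    by simp
  have uG: "u \<in> carrier G" unfolding carrier_iff using u(1) by blast
  \<comment> \<open>Below \<open>k\<close> the element \<open>v\<close> is trivial, and so is the
    relation; from \<open>k\<close> on it is \<open>conjugate_pow\<close> in each
    coordinate.\<close>
  have rel: "u \<otimes>\<^bsub>G\<^esub> v [^]\<^bsub>G\<^esub> (4::nat) = v \<otimes>\<^bsub>G\<^esub> u"
  proof
    fix j
    interpret Sj: group "S j" by (rule grp)
    show "(u \<otimes>\<^bsub>G\<^esub> v [^]\<^bsub>G\<^esub> (4::nat)) j = (v \<otimes>\<^bsub>G\<^esub> u) j"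
      unfolding mult_apply pow_apply v_def
      using Sj.conjugate_pow[OF u(1) z(1) u(2), of "m j"] u(1)[of j] by simp
  qed
  have "v [^]\<^bsub>G\<^esub> D = (\<lambda>j. if k \<le> j then z j [^]\<^bsub>S j\<^esub> e j else \<one>\<^bsub>S j\<^esub>)"
  proof
    fix j
    interpret Sj: group "S j" by (rule grp)
    show "(v [^]\<^bsub>G\<^esub> D) j = (if k \<le> j then z j [^]\<^bsub>S j\<^esub> e j else \<one>\<^bsub>S j\<^esub>)"
      unfolding pow_apply v_def using Sj.pow_eq_of_cong[OF z m] z(1)[of j] by (simp add: Sj.nat_pow_pow)
  qed
  thus ?thesis
    using rep_trivial_of_conjugate_power[OF G.is_group \<rho>(1,2) v uG rel _ \<rho>(3)] unfolding D_def by simp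
qed

text \<open>By the bounded word length, \<open>g\<close> is a product of four tail elements, each
  consisting of powers of only the \<open>x j\<close> or only the \<open>y j\<close>, and
  \<open>\<rho>\<close> is trivial on each of the four.\<close>

lemma rep_trivial_on_tail:
  assumes \<rho>: "\<rho> \<in> hom G (GL i)" "finite (rcosets\<^bsub>G\<^esub> (kernel G (GL i) \<rho>))" "i \<le> n"
    and k: "\<And>j. k \<le> j \<Longrightarrow> 4 ^ n < p j"
    and g: "g \<in> carrier G" "\<And>j. j < k \<Longrightarrow> g j = \<one>\<^bsub>S j\<^esub>"
  shows "\<rho> g = 1\<^sub>m i"
proof -
  obtain a b c d :: "nat \<Rightarrow> nat" where co: "\<forall>j. g j = x j [^]\<^bsub>S j\<^esub> a j \<otimes>\<^bsub>S j\<^esub>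
      (y j [^]\<^bsub>S j\<^esub> b j \<otimes>\<^bsub>S j\<^esub> (x j [^]\<^bsub>S j\<^esub> c j \<otimes>\<^bsub>S j\<^esub> y j [^]\<^bsub>S j\<^esub> d j))"
      using unipotent_coordinates[OF g(1)] by (elim exE) (rule that)
  define X' where "X' e = (\<lambda>j. if k \<le> j then x j [^]\<^bsub>S j\<^esub> (e j :: nat) else \<one>\<^bsub>S j\<^esub>)" for e
  define Y' where "Y' e = (\<lambda>j. if k \<le> j then y j [^]\<^bsub>S j\<^esub> (e j :: nat) else \<one>\<^bsub>S j\<^esub>)" for e
  have c: "X' e \<in> carrier G" "Y' e \<in> carrier G" for e
    unfolding X'_def Y'_def carrier_iff
    using monoid.nat_pow_closed[OF group.is_monoid[OF grp] x(1)] monoid.nat_pow_closed[OF group.is_monoid[OF grp] y(1)]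
      monoid.one_closed[OF group.is_monoid[OF grp]] by simp_all
  have r: "\<rho> (X' e) = 1\<^sub>m i" "\<rho> (Y' e) = 1\<^sub>m i" for e
    unfolding X'_def Y'_def
    by (rule rep_trivial_on_tail_unipotent[OF \<rho> k x(1,2) s] rep_trivial_on_tail_unipotent[OF \<rho> k y t]; assumption)+
  have "g = X' a \<otimes>\<^bsub>G\<^esub> (Y' b \<otimes>\<^bsub>G\<^esub> (X' c \<otimes>\<^bsub>G\<^esub> Y' d))"
  proof
    fix j
    interpret Sj: group "S j" by (rule grp)
    show "g j = (X' a \<otimes>\<^bsub>G\<^esub> (Y' b \<otimes>\<^bsub>G\<^esub> (X' c \<otimes>\<^bsub>G\<^esub> Y' d))) j"
    proof (cases "k \<le> j")
      case True
      thus ?thesis unfolding mult_apply X'_def Y'_def using co[rule_format, of j] by simp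
    next
      case False
      thus ?thesis unfolding mult_apply X'_def Y'_def using g(2)[of j] by simp
    qed
  qed
  thus ?thesis using c by (simp only: rep_mult[OF \<rho>(1)] G.m_closed r) simp
qed

text \<open>Every element is a product of one supported on the first \<open>k\<close> coordinates
  and one in the tail. The tail acts trivially, so the finite subgroup \<open>H\<close> of elements
  of the first kind realises all values.\<close>

lemma R_irr_le_prod_card:
  assumes k: "\<And>j. k \<le> j \<Longrightarrow> 4 ^ n < p j"
  shows "R_irr G n \<le> enat (\<Prod>j<k. card (carrier (S j)))"
proof -
  define H where "H = (\<Pi>\<^sub>E j\<in>UNIV. if j < k then carrier (S j) else {\<one>\<^bsub>S j\<^esub>})"
  have Hiff: "h \<in> H \<longleftrightarrow> (\<forall>j. if j < k then h j \<in> carrier (S j) else h j = \<one>\<^bsub>S j\<^esub>)" for h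
    unfolding H_def by (auto simp: PiE_iff split: if_splits)
  have sub: "subgroup H G"
    unfolding H_def using grp group.triv_subgroup[OF grp] group.subgroup_self[OF grp]
    by (subst PiE_subgroup_product_group) auto
  have inj: "inj_on (\<lambda>h. restrict h {..<k}) H"
  proof (rule inj_onI)
    fix h h' assume h: "h \<in> H" "h' \<in> H" "restrict h {..<k} = restrict h' {..<k}"
    show "h = h'"
    proof
      fix j
      show "h j = h' j"
      proof (cases "j < k")
        case True
        thus ?thesis using fun_cong[OF h(3), of j] by simp
      next
        case False
        thus ?thesis using h(1,2) unfolding Hiff by metis
      qed
    qed
  qed
  have img: "(\<lambda>h. restrict h {..<k}) ` H \<subseteq> (\<Pi>\<^sub>E j\<in>{..<k}. carrier (S j))"
    using Hiff by (auto simp: PiE_iff extensional_def split: if_splits)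
  have finP: "finite (\<Pi>\<^sub>E j\<in>{..<k}. carrier (S j))" using fin by (intro finite_PiE) auto
  have finH: "finite H" using inj_on_finite[OF inj img finP] .
  have "card H \<le> card (\<Pi>\<^sub>E j\<in>{..<k}. carrier (S j))" by (rule card_inj_on_le[OF inj img finP])
  also have "\<dots> = (\<Prod>j<k. card (carrier (S j)))" by (simp add: card_PiE)
  finally have cardH: "card H \<le> (\<Prod>j<k. card (carrier (S j)))" .
  have "R_irr G n \<le> enat (card H)"
  proof (rule R_irr_le_card[OF G.is_group sub finH])
    fix g assume g: "g \<in> carrier G"
    define h where "h = (\<lambda>j. if j < k then g j else \<one>\<^bsub>S j\<^esub>)"
    define r where "r = (\<lambda>j. if j < k then \<one>\<^bsub>S j\<^esub> else g j)"
    have h: "h \<in> H" using g unfolding Hiff h_def carrier_iff by simp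
    have hG: "h \<in> carrier G" using subgroup.mem_carrier[OF sub h] .
    have rG: "r \<in> carrier G" using g monoid.one_closed[OF group.is_monoid[OF grp]] unfolding carrier_iff r_def by simp
    have "g = h \<otimes>\<^bsub>G\<^esub> r"
    proof
      fix j
      interpret Sj: group "S j" by (rule grp)
      show "g j = (h \<otimes>\<^bsub>G\<^esub> r) j" unfolding mult_apply h_def r_def using g[unfolded carrier_iff] by simp
    qed
    moreover have "\<rho> (h \<otimes>\<^bsub>G\<^esub> r) = \<rho> h" if i: "i \<in> {1..n}" and "\<rho> \<in> finite_index_irreps G i" for i \<rho>
    proof -
      have \<rho>: "\<rho> \<in> hom G (GL i)" "finite (rcosets\<^bsub>G\<^esub> (kernel G (GL i) \<rho>))"
        using that unfolding finite_index_irreps_def irreducible_rep_def by auto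
      have "\<rho> r = 1\<^sub>m i"
        by (rule rep_trivial_on_tail[OF \<rho> _ k rG]) (use i in \<open>auto simp: r_def\<close>)
      thus ?thesis using rep_mult[OF \<rho>(1) hG rG] rep_carrier[OF \<rho>(1) hG] by simp
    qed
    ultimately show "\<exists>h\<in>H. \<forall>i\<in>{1..n}. \<forall>\<rho>\<in>finite_index_irreps G i. \<rho> g = \<rho> h"
      using h by (intro bexI[of _ h]) simp_all
  qed
  also have "\<dots> \<le> enat (\<Prod>j<k. card (carrier (S j)))" using cardH by simp
  finally show ?thesis .
qed

end

section \<open>The groups \<open>SL\<^sub>2(\<int>/p)\<close>\<close>

text \<open>The quadruple \<open>(a, b, c, d)\<close> is the matrix with rows \<open>(a, b)\<close>
  and \<open>(c, d)\<close>. Entries are canonical residues, so that equality of matrices is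
  equality of tuples.\<close>

definition SL2 :: "int \<Rightarrow> (int \<times> int \<times> int \<times> int) monoid" where
  "SL2 p = \<lparr>carrier = {(a, b, c, d). a \<in> {0..<p} \<and> b \<in> {0..<p} \<and> c \<in> {0..<p} \<and> d \<in> {0..<p} \<and>
                        (a * d - b * c) mod p = 1},
            mult = \<lambda>(a, b, c, d) (a', b', c', d').
              ((a * a' + b * c') mod p, (a * b' + b * d') mod p,
               (c * a' + d * c') mod p, (c * b' + d * d') mod p),
            one = (1, 0, 0, 1)\<rparr>"

lemma SL2_mult [simp]:
  "(a, b, c, d) \<otimes>\<^bsub>SL2 p\<^esub> (a', b', c', d') =
     ((a * a' + b * c') mod p, (a * b' + b * d') mod p, (c * a' + d * c') mod p, (c * b' + d * d') mod p)"
  and SL2_one [simp]: "\<one>\<^bsub>SL2 p\<^esub> = (1, 0, 0, 1)"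
  and SL2_carrier: "(a, b, c, d) \<in> carrier (SL2 p) \<longleftrightarrow>
     a \<in> {0..<p} \<and> b \<in> {0..<p} \<and> c \<in> {0..<p} \<and> d \<in> {0..<p} \<and> (a * d - b * c) mod p = 1"
  by (simp_all add: SL2_def)

text \<open>Removes the inner reductions from the entries of a triple product, which settles
  associativity.\<close>

lemma mod_bilinear:
  fixes p :: int
  shows "(x mod p * y + z mod p * w) mod p = (x * y + z * w) mod p"
    and "(y * (x mod p) + w * (z mod p)) mod p = (y * x + w * z) mod p"
  unfolding cong_def[symmetric] by (intro cong_add cong_mult; simp add: cong_def)+

lemma group_SL2:
  assumes p: "p > 1"
  shows "group (SL2 p)"
proof (rule groupI)
  fix x y assume "x \<in> carrier (SL2 p)" "y \<in> carrier (SL2 p)"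
  then obtain a b c d a' b' c' d' where xy: "x = (a, b, c, d)" "y = (a', b', c', d')"
    and det: "(a * d - b * c) mod p = 1" "(a' * d' - b' * c') mod p = 1"
    by (cases x; cases y) (auto simp: SL2_carrier)
  have "((a * a' + b * c') mod p * ((c * b' + d * d') mod p) -
      (a * b' + b * d') mod p * ((c * a' + d * c') mod p)) mod p
    = ((a * a' + b * c') * (c * b' + d * d') - (a * b' + b * d') * (c * a' + d * c')) mod p"
    unfolding cong_def[symmetric] by (intro cong_diff cong_mult) (simp_all add: cong_def)
  also have "(a * a' + b * c') * (c * b' + d * d') - (a * b' + b * d') * (c * a' + d * c') =
    (a * d - b * c) * (a' * d' - b' * c')" by (simp add: algebra_simps)
  also have "\<dots> mod p = ((a * d - b * c) mod p) * ((a' * d' - b' * c') mod p) mod p"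
    by (simp add: mod_mult_eq)
  also have "\<dots> = 1" using det p by simp
  finally show "x \<otimes>\<^bsub>SL2 p\<^esub> y \<in> carrier (SL2 p)" using p by (simp add: xy SL2_carrier)
next
  fix x y z
  show "x \<otimes>\<^bsub>SL2 p\<^esub> y \<otimes>\<^bsub>SL2 p\<^esub> z = x \<otimes>\<^bsub>SL2 p\<^esub> (y \<otimes>\<^bsub>SL2 p\<^esub> z)"
    by (cases x; cases y; cases z) (simp only: SL2_mult mod_bilinear, simp add: algebra_simps)
next
  fix x assume x: "x \<in> carrier (SL2 p)"
  obtain a b c d where xe: "x = (a, b, c, d)" by (cases x)
  show "\<one>\<^bsub>SL2 p\<^esub> \<otimes>\<^bsub>SL2 p\<^esub> x = x" using x by (simp add: xe SL2_carrier)
  \<comment> \<open>The inverse is the adjugate matrix \<open>(d, b', c', a)\<close>.\<close>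
  define b' c' where "b' = (- b) mod p" and "c' = (- c) mod p"
  have b: "[b' = - b] (mod p)" and c: "[c' = - c] (mod p)" by (simp_all add: b'_def c'_def cong_def)
  have det: "[a * d - b * c = 1] (mod p)" using x p by (simp add: xe SL2_carrier cong_def)
  have "[d * a + b' * c = d * a + (- b) * c] (mod p)" "[d * b + b' * d = d * b + (- b) * d] (mod p)"
    "[c' * a + a * c = (- c) * a + a * c] (mod p)" "[c' * b + a * d = (- c) * b + a * d] (mod p)"
    "[d * a - b' * c' = d * a - (- b) * (- c)] (mod p)"
    by (intro cong_add cong_diff cong_mult cong_refl b c)+
  hence "(d * a + b' * c) mod p = 1" "(d * b + b' * d) mod p = 0"
    "(c' * a + a * c) mod p = 0" "(c' * b + a * d) mod p = 1" "(d * a - b' * c') mod p = 1"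
    using det p by (simp_all add: cong_def algebra_simps)
  moreover have "b' \<in> {0..<p}" "c' \<in> {0..<p}" using p by (simp_all add: b'_def c'_def)
  ultimately show "\<exists>y\<in>carrier (SL2 p). y \<otimes>\<^bsub>SL2 p\<^esub> x = \<one>\<^bsub>SL2 p\<^esub>"
    using x by (intro bexI[of _ "(d, b', c', a)"]) (auto simp: xe SL2_carrier)
qed (use p in \<open>simp add: SL2_carrier\<close>)

lemma finite_SL2: "finite (carrier (SL2 p))"
  and card_SL2_le: "card (carrier (SL2 p)) \<le> nat p ^ 4"
proof -
  have sub: "carrier (SL2 p) \<subseteq> {0..<p} \<times> {0..<p} \<times> {0..<p} \<times> {0..<p}"
    unfolding SL2_def by auto
  show "finite (carrier (SL2 p))" by (rule finite_subset[OF sub]) simp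
  have "card (carrier (SL2 p)) \<le> card ({0..<p} \<times> {0..<p} \<times> {0..<p} \<times> {0..<p})"
    by (rule card_mono[OF _ sub]) simp
  thus "card (carrier (SL2 p)) \<le> nat p ^ 4"
    by (simp add: card_cartesian_product power4_eq_xxxx mult_ac)
qed

lemma SL2_upper_pow:
  assumes "p > 1"
  shows "(1, 1, 0, 1) [^]\<^bsub>SL2 p\<^esub> (k::nat) = (1, int k mod p, 0, 1)"
  using assms by (induction k) (simp_all add: mod_simps algebra_simps)

lemma SL2_lower_pow:
  assumes "p > 1"
  shows "(1, 0, 1, 1) [^]\<^bsub>SL2 p\<^esub> (k::nat) = (1, 0, int k mod p, 1)"
  using assms by (induction k) (simp_all add: mod_simps algebra_simps)

text \<open>For invertible \<open>c\<close> the three exponents are explicit: (a - 1)/c, c and (d -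
  1)/c modulo \<open>p\<close>.\<close>

lemma SL2_eq_upper_lower_upper:
  assumes p: "prime p" "p > 1" and g: "(a, b, c, d) \<in> carrier (SL2 p)" and c: "c \<noteq> 0"
  shows "\<exists>(k::nat) (l::nat) (m::nat). (a, b, c, d) = (1, 1, 0, 1) [^]\<^bsub>SL2 p\<^esub> k \<otimes>\<^bsub>SL2 p\<^esub>
    ((1, 0, 1, 1) [^]\<^bsub>SL2 p\<^esub> l \<otimes>\<^bsub>SL2 p\<^esub> (1, 1, 0, 1) [^]\<^bsub>SL2 p\<^esub> m)"
proof -
  have r: "0 \<le> a" "a < p" "0 \<le> b" "b < p" "0 \<le> c" "c < p" "0 \<le> d" "d < p"
    and det: "(a * d - b * c) mod p = 1" using g by (auto simp: SL2_carrier)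
  have "coprime c p"
    using p c r by (metis coprime_commute prime_imp_coprime zdvd_not_zless order_le_less)
  then obtain e where e: "[c * e = 1] (mod p)" using cong_solve_coprime_int by blast
  define k m where "k = nat ((a - 1) * e mod p)" and "m = nat ((d - 1) * e mod p)"
  have k: "[int k mod p = (a - 1) * e] (mod p)" and m: "[int m mod p = (d - 1) * e] (mod p)"
    unfolding k_def m_def using p by (simp_all add: cong_def)
  have det': "[a * d - b * c = 1] (mod p)" using det p by (simp add: cong_def)
  have 1: "[1 + int k mod p * c = a] (mod p)"
  proof -
    have "[1 + int k mod p * c = 1 + (a - 1) * e * c] (mod p)" by (intro cong_add cong_mult cong_refl k)
    also have "1 + (a - 1) * e * c = 1 + (a - 1) * (c * e)" by simp
    also have "[\<dots> = 1 + (a - 1) * 1] (mod p)" by (intro cong_add cong_mult cong_refl e)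
    finally show ?thesis by simp
  qed
  have 2: "[c * (int m mod p) + 1 = d] (mod p)"
  proof -
    have "[c * (int m mod p) + 1 = c * ((d - 1) * e) + 1] (mod p)" by (intro cong_add cong_mult cong_refl m)
    also have "c * ((d - 1) * e) + 1 = (d - 1) * (c * e) + 1" by simp
    also have "[\<dots> = (d - 1) * 1 + 1] (mod p)" by (intro cong_add cong_mult cong_refl e)
    finally show ?thesis by simp
  qed
  \<comment> \<open>Here the determinant enters: as \<open>c\<close> is invertible, it forces the
    upper right entry once the other three agree.\<close>
  have 3: "[int m mod p + int k mod p * ((c * (int m mod p) + 1) mod p) = b] (mod p)"
  proof -
    have "[int m mod p + int k mod p * ((c * (int m mod p) + 1) mod p) = (d - 1) * e + (a - 1) * e * d] (mod p)"
      by (intro cong_add cong_mult k m cong_trans[OF _ 2]) (simp add: cong_def)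
    also have "(d - 1) * e + (a - 1) * e * d = (a * d - b * c - 1) * e + b * (c * e)"
      by (simp add: algebra_simps)
    also have "[\<dots> = (1 - 1) * e + b * 1] (mod p)"
      by (intro cong_add cong_mult cong_diff cong_refl e det')
    finally show ?thesis by simp
  qed
  have l: "int (nat c) = c" using r by simp
  have *: "(a, b, c, d) = (1, 1, 0, 1) [^]\<^bsub>SL2 p\<^esub> k \<otimes>\<^bsub>SL2 p\<^esub>
    ((1, 0, 1, 1) [^]\<^bsub>SL2 p\<^esub> nat c \<otimes>\<^bsub>SL2 p\<^esub> (1, 1, 0, 1) [^]\<^bsub>SL2 p\<^esub> m)"
    using 1 2 3 r p(2) unfolding SL2_upper_pow[OF p(2)] SL2_lower_pow[OF p(2)] l cong_def
    by (simp add: mod_simps)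
  show ?thesis by (rule exI[of _ k], rule exI[of _ "nat c"], rule exI[of _ m], rule *)
qed

text \<open>A vanishing lower left entry is made nonzero by a right multiplication with a lower
  unipotent, which costs the fourth factor.\<close>

lemma SL2_eq_upper_lower_upper_lower:
  assumes p: "prime p" and g: "g \<in> carrier (SL2 p)"
  shows "\<exists>(k::nat) (l::nat) (m::nat) (n::nat). g = (1, 1, 0, 1) [^]\<^bsub>SL2 p\<^esub> k \<otimes>\<^bsub>SL2 p\<^esub>
    ((1, 0, 1, 1) [^]\<^bsub>SL2 p\<^esub> l \<otimes>\<^bsub>SL2 p\<^esub>
    ((1, 1, 0, 1) [^]\<^bsub>SL2 p\<^esub> m \<otimes>\<^bsub>SL2 p\<^esub> (1, 0, 1, 1) [^]\<^bsub>SL2 p\<^esub> n))"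
proof -
  have p1: "p > 1" using prime_gt_1_int[OF p] .
  interpret group "SL2 p" by (rule group_SL2[OF p1])
  define x y where "x = (1::int, 1::int, 0::int, 1::int)" and "y = (1::int, 0::int, 1::int, 1::int)"
  have xy: "x \<in> carrier (SL2 p)" "y \<in> carrier (SL2 p)" using p1 by (simp_all add: x_def y_def SL2_carrier)
  obtain a b c d where ge: "g = (a, b, c, d)" by (cases g)
  \<comment> \<open>If \<open>c = 0\<close>, then \<open>h\<close> is \<open>g\<close> times
    \<open>y\<close>, with lower left entry \<open>d\<close>, a unit; otherwise the exponent is
    \<open>p\<close> and \<open>h\<close> is \<open>g\<close>. In both cases multiplying
    \<open>h\<close> by the \<open>n\<close>-th power of \<open>y\<close> recovers
    \<open>g\<close>.\<close>
  define n where "n = (if c = 0 then nat (p - 1) else 0)"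
  define h where "h = g \<otimes>\<^bsub>SL2 p\<^esub> y [^]\<^bsub>SL2 p\<^esub> (nat p - n)"
  have yp: "y [^]\<^bsub>SL2 p\<^esub> nat p = \<one>\<^bsub>SL2 p\<^esub>"
    unfolding y_def SL2_lower_pow[OF p1] using p1 by simp
  have h: "h \<in> carrier (SL2 p)" unfolding h_def using g xy by simp
  obtain a' b' c' d' where he: "h = (a', b', c', d')" by (cases h)
  have "c' \<noteq> 0"
  proof (cases "c = 0")
    case True
    have "nat p - n = 1" using True p1 by (simp add: n_def)
    hence "c' = d" using g he p1 unfolding h_def ge y_def SL2_lower_pow[OF p1] True
      by (simp add: SL2_carrier)
    thus ?thesis using g p1 True unfolding ge by (auto simp: SL2_carrier)
  next
    case False
    hence "h = g" unfolding h_def n_def using yp g by (simp del: SL2_one)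
    thus ?thesis using False he ge by simp
  qed
  then obtain k l m :: nat where klm: "h = x [^]\<^bsub>SL2 p\<^esub> k \<otimes>\<^bsub>SL2 p\<^esub> (y [^]\<^bsub>SL2 p\<^esub> l \<otimes>\<^bsub>SL2 p\<^esub> x [^]\<^bsub>SL2 p\<^esub> m)"
    using SL2_eq_upper_lower_upper[OF p p1, of a' b' c' d'] h he unfolding x_def y_def by auto
  have "n \<le> nat p" unfolding n_def by (simp add: nat_mono)
  hence "h \<otimes>\<^bsub>SL2 p\<^esub> y [^]\<^bsub>SL2 p\<^esub> n = g"
    unfolding h_def using g xy yp by (simp add: m_assoc nat_pow_mult del: SL2_one)
  hence *: "g = x [^]\<^bsub>SL2 p\<^esub> k \<otimes>\<^bsub>SL2 p\<^esub> (y [^]\<^bsub>SL2 p\<^esub> l \<otimes>\<^bsub>SL2 p\<^esub> (x [^]\<^bsub>SL2 p\<^esub> m \<otimes>\<^bsub>SL2 p\<^esub> y [^]\<^bsub>SL2 p\<^esub> n))"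
    unfolding klm using xy by (simp add: m_assoc)
  show ?thesis
    by (rule exI[of _ k], rule exI[of _ l], rule exI[of _ m], rule exI[of _ n], rule *[unfolded x_def y_def])
qed

section \<open>Transport to the natural numbers and conjugation by diagonal matrices\<close>

text \<open>Encoding the elements by natural numbers puts the product into the type of functions
  from naturals to naturals, over which the theorem quantifies.\<close>

definition nat_copy :: "('a :: countable) monoid \<Rightarrow> nat monoid" where
  "nat_copy G = \<lparr>carrier = to_nat ` carrier G,
     mult = \<lambda>x y. to_nat (from_nat x \<otimes>\<^bsub>G\<^esub> from_nat y), one = to_nat \<one>\<^bsub>G\<^esub>\<rparr>"

lemma nat_copy_simps [simp]:
  "carrier (nat_copy G) = to_nat ` carrier G" "\<one>\<^bsub>nat_copy G\<^esub> = to_nat \<one>\<^bsub>G\<^esub>"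
  "to_nat x \<otimes>\<^bsub>nat_copy G\<^esub> to_nat y = to_nat (x \<otimes>\<^bsub>G\<^esub> y)"
  by (simp_all add: nat_copy_def)

lemma nat_copy_pow [simp]: "to_nat x [^]\<^bsub>nat_copy G\<^esub> (k::nat) = to_nat (x [^]\<^bsub>G\<^esub> k)"
  by (induction k) simp_all

lemma group_nat_copy:
  assumes "group G"
  shows "group (nat_copy G)"
proof -
  interpret group G by fact
  show ?thesis
  proof (rule groupI)
    fix x assume "x \<in> carrier (nat_copy G)"
    then obtain x' where x': "x' \<in> carrier G" "x = to_nat x'" by auto
    show "\<exists>y\<in>carrier (nat_copy G). y \<otimes>\<^bsub>nat_copy G\<^esub> x = \<one>\<^bsub>nat_copy G\<^esub>"
      using x' by (intro bexI[of _ "to_nat (inv\<^bsub>G\<^esub> x')"]) auto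
  qed (auto simp: m_assoc)
qed

text \<open>This is the source of the exponent 4. Since \<open>h\<close> is the inverse of 2 modulo
  \<open>p\<close>, conjugation by these diagonal matrices divides the off-diagonal entry of the
  unipotent by the square of 2.\<close>

lemma SL2_diagonal_conjugation:
  assumes "prime p" "p > (4::int)"
  defines "h \<equiv> (p + 1) div 2"
  shows "(h, 0, 0, 2) \<in> carrier (SL2 p)" "(2, 0, 0, h) \<in> carrier (SL2 p)"
    and "(h, 0, 0, 2) \<otimes>\<^bsub>SL2 p\<^esub> (1, 1, 0, 1) [^]\<^bsub>SL2 p\<^esub> (4::nat) = (1, 1, 0, 1) \<otimes>\<^bsub>SL2 p\<^esub> (h, 0, 0, 2)"
    and "(2, 0, 0, h) \<otimes>\<^bsub>SL2 p\<^esub> (1, 0, 1, 1) [^]\<^bsub>SL2 p\<^esub> (4::nat) = (1, 0, 1, 1) \<otimes>\<^bsub>SL2 p\<^esub> (2, 0, 0, h)"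
proof -
  have "odd p" using prime_odd_int[of p] assms(1,2) by simp
  hence h2: "2 * h = p + 1" unfolding h_def by presburger
  have hr: "0 \<le> h" "h < p" using h2 assms(2) by auto
  have 1: "(h * 2) mod p = 1" "(2 * h) mod p = 1" using h2 assms(2) by (simp_all add: mult.commute)
  have "h * 4 = 2 + p * 2" using h2 by simp
  hence 2: "(h * 4) mod p = 2" using assms(2) by (simp only: mod_mult_self2) simp
  show "(h, 0, 0, 2) \<in> carrier (SL2 p)" "(2, 0, 0, h) \<in> carrier (SL2 p)"
    using hr 1 assms(2) by (simp_all add: SL2_carrier)
  have p1: "p > 1" using assms(2) by simp
  show "(h, 0, 0, 2) \<otimes>\<^bsub>SL2 p\<^esub> (1, 1, 0, 1) [^]\<^bsub>SL2 p\<^esub> (4::nat) = (1, 1, 0, 1) \<otimes>\<^bsub>SL2 p\<^esub> (h, 0, 0, 2)"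
    unfolding SL2_upper_pow[OF p1] using hr 2 assms(2) by simp
  show "(2, 0, 0, h) \<otimes>\<^bsub>SL2 p\<^esub> (1, 0, 1, 1) [^]\<^bsub>SL2 p\<^esub> (4::nat) = (1, 0, 1, 1) \<otimes>\<^bsub>SL2 p\<^esub> (2, 0, 0, h)"
    unfolding SL2_lower_pow[OF p1] using hr 2 assms(2) by simp
qed

lemma unipotent_family_SL2:
  fixes p :: "nat \<Rightarrow> nat"
  assumes p: "\<And>j. prime (p j)" "\<And>j. p j > 4" and inj: "inj p"
  shows "unipotent_family (\<lambda>j. nat_copy (SL2 (int (p j)))) p
    (\<lambda>j. to_nat (1::int, 1::int, 0::int, 1::int)) (\<lambda>j. to_nat (1::int, 0::int, 1::int, 1::int))
    (\<lambda>j. to_nat ((int (p j) + 1) div 2, 0::int, 0::int, 2::int))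
    (\<lambda>j. to_nat (2::int, 0::int, 0::int, (int (p j) + 1) div 2))"
proof -
  have pI: "prime (int (p j))" "int (p j) > 4" "int (p j) > 1" for j
    using p(1)[of j] p(2)[of j] by simp_all
  note d = SL2_diagonal_conjugation[OF pI(1,2)]
  show ?thesis
  proof (intro unipotent_family.intro finite_group_family.intro unipotent_family_axioms.intro)
    fix j
    show "group (nat_copy (SL2 (int (p j))))" by (rule group_nat_copy[OF group_SL2[OF pI(3)]])
    show "finite (carrier (nat_copy (SL2 (int (p j)))))" using finite_SL2 by simp
    show "prime (p j)" by (rule p)
    fix g assume "g \<in> carrier (nat_copy (SL2 (int (p j))))"
    then obtain g' where g': "g' \<in> carrier (SL2 (int (p j)))" "g = to_nat g'" by auto
    from SL2_eq_upper_lower_upper_lower[OF pI(1) g'(1)]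
    show "\<exists>(a::nat) (b::nat) (c::nat) (d::nat). g = to_nat (1::int, 1::int, 0::int, 1::int) [^]\<^bsub>nat_copy (SL2 (int (p j)))\<^esub> a
      \<otimes>\<^bsub>nat_copy (SL2 (int (p j)))\<^esub> (to_nat (1::int, 0::int, 1::int, 1::int) [^]\<^bsub>nat_copy (SL2 (int (p j)))\<^esub> b
      \<otimes>\<^bsub>nat_copy (SL2 (int (p j)))\<^esub> (to_nat (1::int, 1::int, 0::int, 1::int) [^]\<^bsub>nat_copy (SL2 (int (p j)))\<^esub> c
      \<otimes>\<^bsub>nat_copy (SL2 (int (p j)))\<^esub> to_nat (1::int, 0::int, 1::int, 1::int) [^]\<^bsub>nat_copy (SL2 (int (p j)))\<^esub> d))"
      unfolding g'(2) nat_copy_pow nat_copy_simps to_nat_split .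
  qed (use inj pI d in \<open>simp_all add: SL2_carrier SL2_upper_pow SL2_lower_pow del: SL2_mult\<close>)
qed

section \<open>Choice of the primes and conclusion\<close>

text \<open>The primes are chosen recursively. The number \<open>p k ^ (4 * Suc k)\<close> will
  bound the product of the orders of the first \<open>k + 1\<close> factors; \<open>N k\<close> is
  taken where \<open>f\<close> exceeds it, and only then the next prime beyond
  \<open>4 ^ N k\<close>.\<close>

lemma exists_sparse_primes:
  fixes f :: "nat \<Rightarrow> nat"
  assumes f: "filterlim f at_top at_top"
  obtains p :: "nat \<Rightarrow> nat" and N :: "nat \<Rightarrow> nat"
  where "\<And>j. prime (p j)" "\<And>j. p j > 4" "strict_mono p"
    "\<And>k. k \<le> N k" "\<And>k. 4 ^ N k < p (Suc k)" "\<And>k. p k ^ (4 * Suc k) < f (N k)"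
proof -
  have "\<exists>p. \<forall>k. (prime (p k) \<and> p k > 4) \<and>
      (p k < p (Suc k) \<and> (\<exists>n. k \<le> n \<and> 4 ^ n < p (Suc k) \<and> p k ^ (4 * Suc k) < f n))"
  proof (rule dependent_nat_choice)
    show "\<exists>q::nat. prime q \<and> q > 4" using bigger_prime by blast
  next
    fix q k :: nat
    obtain M where M: "\<And>n. n \<ge> M \<Longrightarrow> f n \<ge> Suc (q ^ (4 * Suc k))"
      using f unfolding filterlim_at_top eventually_at_top_linorder by meson
    \<comment> \<open>The bound \<open>M\<close> makes \<open>f n\<close> large; the bound
      \<open>k\<close> makes the chosen values unbounded, hence infinitely many.\<close>
    define n where "n = max M k"
    obtain q' where "prime q'" "q' > max (max 4 q) (4 ^ n)" using bigger_prime by blast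
    thus "\<exists>q'. (prime q' \<and> q' > 4) \<and> q < q' \<and> (\<exists>n. k \<le> n \<and> 4 ^ n < q' \<and> q ^ (4 * Suc k) < f n)"
      using M[of n] unfolding n_def by (intro exI[of _ q'] conjI exI[of _ "max M k"]) (auto simp: Suc_le_eq)
  qed
  then obtain p where p: "\<forall>k. (prime (p k) \<and> p k > 4) \<and>
      (p k < p (Suc k) \<and> (\<exists>n. k \<le> n \<and> 4 ^ n < p (Suc k) \<and> p k ^ (4 * Suc k) < f n))" by blast
  hence "\<forall>k. \<exists>n. k \<le> n \<and> 4 ^ n < p (Suc k) \<and> p k ^ (4 * Suc k) < f n" by blast
  from choice[OF this] obtain N where "\<forall>k. k \<le> N k \<and> 4 ^ N k < p (Suc k) \<and> p k ^ (4 * Suc k) < f (N k)" ..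
  thus ?thesis using p by (intro that[of p N]) (auto simp: strict_mono_Suc_iff)
qed

text \<open>At \<open>n = N k\<close> all primes after \<open>p k\<close> exceed
  \<open>4 ^ n\<close>, so only the first \<open>k + 1\<close> factors contribute to
  \<open>R_irr G n\<close>, and \<open>f n\<close> was chosen beyond their bound.\<close>

lemma exists_slow_R_irr:
  fixes f :: "nat \<Rightarrow> nat"
  assumes f: "filterlim f at_top at_top"
  shows "\<exists>(G :: (nat \<Rightarrow> nat) monoid) T. infinite (carrier G) \<and> profinite_group G T \<and>
    topologically_finitely_generated G T \<and> (\<exists>\<^sub>\<infinity>n. R_irr G n < enat (f n))"
proof -
  obtain p N :: "nat \<Rightarrow> nat" where p: "\<And>j. prime (p j)" "\<And>j. p j > 4" "strict_mono p"
    and N: "\<And>k. k \<le> N k" "\<And>k. 4 ^ N k < p (Suc k)" "\<And>k. p k ^ (4 * Suc k) < f (N k)"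
    using exists_sparse_primes[OF f] by metis
  define S where "S j = nat_copy (SL2 (int (p j)))" for j
  interpret unipotent_family S p "\<lambda>j. to_nat (1::int, 1::int, 0::int, 1::int)" "\<lambda>j. to_nat (1::int, 0::int, 1::int, 1::int)"
    "\<lambda>j. to_nat ((int (p j) + 1) div 2, 0::int, 0::int, 2::int)"
    "\<lambda>j. to_nat (2::int, 0::int, 0::int, (int (p j) + 1) div 2)"
    using unipotent_family_SL2[OF p(1,2) strict_mono_imp_inj_on[OF p(3)]] unfolding S_def .
  have "R_irr G (N k) < enat (f (N k))" for k
  proof -
    have "4 ^ N k < p j" if "Suc k \<le> j" for j
      using N(2)[of k] strict_mono_leD[OF p(3) that] by simp
    hence "R_irr G (N k) \<le> enat (\<Prod>j<Suc k. card (carrier (S j)))" by (rule R_irr_le_prod_card)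
    \<comment> \<open>An element of the \<open>j\<close>-th factor has four entries below
      \<open>p j\<close>, and the primes increase, so every order is at most
      \<open>p k ^ 4\<close>.\<close>
    also have "(\<Prod>j<Suc k. card (carrier (S j))) \<le> (\<Prod>j<Suc k. p k ^ 4)"
    proof (intro prod_mono conjI)
      fix j assume j: "j \<in> {..<Suc k}"
      have "card (carrier (S j)) \<le> card (carrier (SL2 (int (p j))))"
        unfolding S_def by (simp add: card_image_le finite_SL2)
      also have "\<dots> \<le> p j ^ 4" using card_SL2_le[of "int (p j)"] by simp
      also have "\<dots> \<le> p k ^ 4" using strict_mono_leD[OF p(3), of j k] j by (intro power_mono) auto
      finally show "card (carrier (S j)) \<le> p k ^ 4" .
    qed simp
    also have "(\<Prod>j<Suc k. p k ^ 4) = p k ^ (4 * Suc k)" by (simp only: prod_constant card_lessThan power_mult)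
    also have "enat (p k ^ (4 * Suc k)) < enat (f (N k))" using N(3) by simp
    finally show ?thesis by simp
  qed
  hence "\<exists>\<^sub>\<infinity>n. R_irr G n < enat (f n)"
    unfolding INFM_nat_le using N(1) by blast
  thus ?thesis
    using infinite_carrier profinite_group_product topologically_finitely_generated_product by blast
qed

theorem theoremG:
  shows
    "(\<forall>f :: nat \<Rightarrow> nat. mono f \<and> filterlim f at_top at_top \<longrightarrow>
        (\<exists>(G :: (nat \<Rightarrow> nat) monoid) T.
           infinite (carrier G) \<and> profinite_group G T \<and> topologically_finitely_generated G T \<and>
           (\<exists>\<^sub>\<infinity>n. R_irr G n < enat (f n)))) \<and>
     \<not> (\<exists>f :: nat \<Rightarrow> nat. mono f \<and> filterlim f at_top at_top \<and>
          (\<forall>(G :: (nat \<Rightarrow> nat) monoid) T.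
             infinite (carrier G) \<and> profinite_group G T \<and> topologically_finitely_generated G T \<longrightarrow>
             (\<forall>\<^sub>F n in sequentially. enat (f n) < R_irr G n)))"
proof (intro conjI allI impI notI)
  fix f :: "nat \<Rightarrow> nat"
  assume "mono f \<and> filterlim f at_top at_top"
  thus "\<exists>(G :: (nat \<Rightarrow> nat) monoid) T. infinite (carrier G) \<and> profinite_group G T \<and>
    topologically_finitely_generated G T \<and> (\<exists>\<^sub>\<infinity>n. R_irr G n < enat (f n))"
    by (intro exists_slow_R_irr) simp
next
  assume "\<exists>f :: nat \<Rightarrow> nat. mono f \<and> filterlim f at_top at_top \<and>
          (\<forall>(G :: (nat \<Rightarrow> nat) monoid) T.
             infinite (carrier G) \<and> profinite_group G T \<and> topologically_finitely_generated G T \<longrightarrow>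
             (\<forall>\<^sub>F n in sequentially. enat (f n) < R_irr G n))"
  then obtain f :: "nat \<Rightarrow> nat" where f: "filterlim f at_top at_top"
    and fast: "\<And>(G :: (nat \<Rightarrow> nat) monoid) T. infinite (carrier G) \<Longrightarrow> profinite_group G T \<Longrightarrow>
      topologically_finitely_generated G T \<Longrightarrow> \<forall>\<^sub>F n in sequentially. enat (f n) < R_irr G n"
    by blast
  obtain G :: "(nat \<Rightarrow> nat) monoid" and T where G: "infinite (carrier G)" "profinite_group G T"
    "topologically_finitely_generated G T" and slow: "\<exists>\<^sub>\<infinity>n. R_irr G n < enat (f n)"
    using exists_slow_R_irr[OF f] by blast
  obtain M where M: "\<And>n. n \<ge> M \<Longrightarrow> enat (f n) < R_irr G n"
    using fast[OF G] unfolding eventually_sequentially by blast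
  obtain n where "n \<ge> M" "R_irr G n < enat (f n)" using slow unfolding INFM_nat_le by blast
  thus False using M[of n] by simp
qed

end
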